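(* Let $N\ge 3$ be a natural number, $1<\theta<N/2$, $0<\omega<1/\theta$, let $\mathcal{M}\in K(\mathcal{P}(\mathbb{N}))$, and let $\mathfrak{X}_{\mathcal{M}}$ be the Banach space constructed from $N,\theta,\omega,\mathcal{M}$ as described in the context. (1) If $\mathcal{M}$ contains an infinite set, then $\mathfrak{X}_{\mathcal{M}}$ is isomorphic to $c_0$. (2) If $\mathcal{M}$ consists of finite sets only, then $\mathfrak{X}_{\mathcal{M}}$ does not contain an isomorphic copy of $c_0$.
   Context: All Banach spaces are real; isomorphism means linear isomorphism. $\mathcal{P}(\mathbb{N})$ is the set of all subsets of $\mathbb{N}=\{1,2,\dots\}$ with the topology of $\{0,1\}^{\mathbb{N}}$, and $K(\mathcal{P}(\mathbb{N}))$ is the family of its compact subsets. Construction of $\mathfrak{X}_{\mathcal{M}}$. Fix $N\ge 3$ natural, $1<\theta<N/2$, $0<\omega<1/\theta$ and $\mathcal{M}\in K(\mathcal{P}(\mathbb{N}))$. Put $\Delta_0=\{0\}$. Pairwise disjoint non-empty finite sets $\Delta_1,\Delta_2,\dots$, numbers $\mathrm{age}(\gamma)\in\{1,\dots,N\}$ for $\gamma\in\bigcup_{i\ge1}\Delta_i$, and functionals $c^*_\gamma$ are defined recursively. Write $\Gamma_p=\bigcup_{i=0}^p\Delta_i$, and $\mathrm{rank}(\gamma)=p$ for $\gamma\in\Delta_p$. For $p\ge1$ and $\gamma\in\Delta_p$, $c^*_\gamma\in(\ell_\infty(\Gamma_{p-1}))^*$; let $i_{p-1,p}:\ell_\infty(\Gamma_{p-1})\to\ell_\infty(\Gamma_p)$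 be $i_{p-1,p}(x)(\gamma)=x(\gamma)$ for $\gamma\in\Gamma_{p-1}$ and $i_{p-1,p}(x)(\gamma)=c^*_\gamma(x)$ for $\gamma\in\Delta_p$. For $p<q$ let $i_{p,q}=i_{q-1,q}\circ\dots\circ i_{p,p+1}$, and $i_{p,p}=\mathrm{id}$. Let $r_{q,p}:\ell_\infty(\Gamma_q)\to\ell_\infty(\Gamma_p)$ be the restriction. For $0\le p\le s\le q$ let $P^q_{[0,p]}=i_{p,q}\circ r_{q,p}$ and $P^q_{(p,s]}=P^q_{[0,s]}-P^q_{[0,p]}$, which defines $P^q_E$ for every interval $E$ of integers in $\{0,\dots,q\}$. For $q\ge0$, $\Delta_{q+1}$ is the set of all tuples of one of two forms: (a) $(q+1,\{\varepsilon_i\}_{i=1}^k,\{E_i\}_{i=1}^k,\{\eta_i\}_{i=1}^k,\{h_i\}_{i=1}^k)$ with $k\in\mathbb{N}$, $\varepsilon_i\in\{-1,1\}$, $E_1<\dots<E_k$ successive non-empty intervals of $\{0,\dots,q\}$, $\eta_i\in\Gamma_q$, $h_i\in\mathbb{N}\cup\{0\}$, such that $\sum_{i=1}^k h_i\le q+1$ and $\sum_{i:\,E_i\cap A\ne\emptyset}h_i<\omega(q+1)$ for all $A\in\mathcal{M}$; (b) if $q\ge2$, $(q+1,\xi,\{\varepsilon_i\}_{i=1}^k,\{E_i\}_{i=1}^k,\{\eta_i\}_{i=1}^k,\{h_i\}_{i=1}^k)$ with $\xi\in\Gamma_{q-1}\setminus\Gamma_0$, $\mathrm{age}(\xi)<N$,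 the $E_i$ successive non-empty intervals of $\{\mathrm{rank}(\xi)+1,\dots,q\}$, and $k,\varepsilon_i,\eta_i,h_i$ as in (a) satisfying the same two requirements. With $e^*_\eta(x)=x(\eta)$: for $\gamma$ of form (a), $\mathrm{age}(\gamma)=1$ and $c^*_\gamma=\frac{\theta}{N}\frac{1}{q+1}\sum_{i=1}^k h_i\varepsilon_i\, e^*_{\eta_i}\circ P^q_{E_i}$; for $\gamma$ of form (b), $\mathrm{age}(\gamma)=\mathrm{age}(\xi)+1$ and $c^*_\gamma=e^*_\xi+\frac{\theta}{N}\frac{1}{q+1}\sum_{i=1}^k h_i\varepsilon_i\, e^*_{\eta_i}\circ P^q_{E_i}$. Finally $\Gamma=\bigcup_{i\ge0}\Delta_i$; for $p\ge0$, $i_p:\ell_\infty(\Gamma_p)\to\ell_\infty(\Gamma)$ is $i_p(x)(\gamma)=x(\gamma)$ for $\gamma\in\Gamma_p$ and $i_p(x)(\gamma)=i_{p,q}(x)(\gamma)$ for $\gamma\in\Delta_q$, $q>p$ (this is a bounded function of $\gamma$). Put $d_\gamma=i_{\mathrm{rank}(\gamma)}(e_\gamma)$, where $e_\gamma=\mathbf{1}_{\{\gamma\}}\in\ell_\infty(\Gamma_{\mathrm{rank}(\gamma)})$, and $\mathfrak{X}_{\mathcal{M}}=\overline{\mathrm{span}}\{d_\gamma:\gamma\in\Gamma\}\subset\ell_\infty(\Gamma)$ with the supremum norm. *)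

theory Defs
  imports "HOL-Analysis.Analysis"
begin

section \<open>Indices\<close>

text \<open>
  Every element of \<open>\<Gamma>\<close> is coded by a tree: \<open>Root\<close> is the point \<open>0\<close> of \<open>\<Delta>\<^sub>0\<close>, \<open>NodeA (q + 1) ts\<close> is
  a tuple of form (a) and \<open>NodeB (q + 1) \<xi> ts\<close> a tuple of form (b).  The four finite sequences
  \<open>\<epsilon>\<^sub>i, E\<^sub>i, \<eta>\<^sub>i, h\<^sub>i\<close> (\<open>1 \<le> i \<le> k\<close>) are zipped into the single list \<open>ts\<close> of the quadruples
  \<open>(\<epsilon>\<^sub>i, E\<^sub>i, \<eta>\<^sub>i, h\<^sub>i)\<close>.
\<close>

datatype node =
    Root
  | NodeA nat "(int \<times> nat set \<times> node \<times> nat) list"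
  | NodeB nat node "(int \<times> nat set \<times> node \<times> nat) list"

text \<open>With the discrete topology on \<^typ>\<open>node\<close>, the type \<open>node \<Rightarrow>\<^sub>C real\<close> is the Banach space of all
  bounded real functions on \<^typ>\<open>node\<close> with the supremum norm.  The space \<open>\<ell>\<^sub>\<infinity>(\<Gamma>)\<close> is identified with
  its subspace of functions vanishing outside \<open>\<Gamma>\<close>; likewise a vector of \<open>\<ell>\<^sub>\<infinity>(\<Gamma>\<^sub>q)\<close> is a function
  \<open>node \<Rightarrow> real\<close> vanishing outside \<open>\<Gamma>\<^sub>q\<close>.\<close>

instantiation node :: discrete_topology
begin

definition open_node :: "node set \<Rightarrow> bool" where
  "open_node S \<longleftrightarrow> True"

instance
  by standard (simp_all add: open_node_def)

end

fun node_rank :: "node \<Rightarrow> nat" where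
  "node_rank Root = 0"
| "node_rank (NodeA n ts) = n"
| "node_rank (NodeB n \<xi> ts) = n"

text \<open>The age of \<^term>\<open>Root\<close> is never used; the value \<open>0\<close> is a dummy.\<close>

fun age :: "node \<Rightarrow> nat" where
  "age Root = 0"
| "age (NodeA n ts) = 1"
| "age (NodeB n \<xi> ts) = Suc (age \<xi>)"

definition interval :: "nat set \<Rightarrow> bool" where
  "interval E \<longleftrightarrow> (\<exists>a b. a \<le> b \<and> E = {a..b})"

section \<open>The construction\<close>

context
  fixes N :: nat and \<theta> \<omega> :: real and \<M> :: "nat set set"
begin

text \<open>The requirements on \<open>(\<epsilon>\<^sub>i), (E\<^sub>i), (\<eta>\<^sub>i), (h\<^sub>i)\<close> in a tuple of \<open>\<Delta>\<^bsub>q+1\<^esub>\<close>: \<open>J\<close> is the set in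
  which the intervals have to lie and \<open>G\<close> stands for \<open>\<Gamma>\<^sub>q\<close>.\<close>

definition admissible ::
    "nat \<Rightarrow> nat set \<Rightarrow> node set \<Rightarrow> (int \<times> nat set \<times> node \<times> nat) list \<Rightarrow> bool" where
  "admissible q J G ts \<longleftrightarrow>
     ts \<noteq> [] \<and>
     (\<forall>(\<epsilon>, E, \<eta>, h) \<in> set ts. \<epsilon> \<in> {-1, 1} \<and> interval E \<and> E \<subseteq> J \<and> \<eta> \<in> G) \<and>
     sorted_wrt (\<lambda>(_, E, _, _) (_, E', _, _). \<forall>a\<in>E. \<forall>b\<in>E'. a < b) ts \<and>
     (\<Sum>(\<epsilon>, E, \<eta>, h)\<leftarrow>ts. h) \<le> q + 1 \<and>
     (\<forall>A\<in>\<M>. real (\<Sum>(\<epsilon>, E, \<eta>, h)\<leftarrow>ts. if E \<inter> A \<noteq> {} then h else 0) < \<omega> * real (q + 1))"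

function Delta :: "nat \<Rightarrow> node set" where
  "Delta 0 = {Root}"
| "Delta (Suc q) =
     {NodeA (Suc q) ts | ts. admissible q {0..q} (\<Union>i\<in>{..q}. Delta i) ts} \<union>
     {NodeB (Suc q) \<xi> ts | \<xi> ts. 2 \<le> q \<and> \<xi> \<in> (\<Union>i\<in>{..q - 1}. Delta i) - Delta 0 \<and> age \<xi> < N \<and>
        admissible q {node_rank \<xi> + 1..q} (\<Union>i\<in>{..q}. Delta i) ts}"
  by pat_completeness auto
termination
  by (relation "Wellfounded.measure id") auto

definition Gamma_upto :: "nat \<Rightarrow> node set" where
  "Gamma_upto q = (\<Union>i\<in>{..q}. Delta i)"

definition Gamma_all :: "node set" where
  "Gamma_all = (\<Union>i. Delta i)"

definition restr :: "nat \<Rightarrow> (node \<Rightarrow> real) \<Rightarrow> (node \<Rightarrow> real)" where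
  "restr p x = (\<lambda>\<gamma>. if \<gamma> \<in> Gamma_upto p then x \<gamma> else 0)"

text \<open>The operators \<open>i\<^bsub>q,q+1\<^esub>\<close>, \<open>i\<^bsub>p,q\<^esub>\<close>, \<open>P\<^bsup>q\<^esup>\<^bsub>[0,p]\<^esub>\<close> and \<open>P\<^bsup>q\<^esup>\<^bsub>E\<^esub>\<close> are functions of a family \<open>c\<close>, where
  \<open>c \<gamma>\<close> plays the role of \<open>c\<^sup>*\<^sub>\<gamma>\<close>, so that they are available while \<open>c\<^sup>*\<close> is being defined.\<close>

definition extend_step ::
    "(node \<Rightarrow> (node \<Rightarrow> real) \<Rightarrow> real) \<Rightarrow> nat \<Rightarrow> (node \<Rightarrow> real) \<Rightarrow> (node \<Rightarrow> real)" where
  "extend_step c q x =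
     (\<lambda>\<gamma>. if \<gamma> \<in> Gamma_upto q then x \<gamma> else if \<gamma> \<in> Delta (Suc q) then c \<gamma> x else 0)"

primrec extend ::
    "(node \<Rightarrow> (node \<Rightarrow> real) \<Rightarrow> real) \<Rightarrow> nat \<Rightarrow> nat \<Rightarrow> (node \<Rightarrow> real) \<Rightarrow> (node \<Rightarrow> real)" where
  "extend c p 0 x = x"
| "extend c p (Suc q) x = (if p \<le> q then extend_step c q (extend c p q x) else x)"

definition proj_init ::
    "(node \<Rightarrow> (node \<Rightarrow> real) \<Rightarrow> real) \<Rightarrow> nat \<Rightarrow> nat \<Rightarrow> (node \<Rightarrow> real) \<Rightarrow> (node \<Rightarrow> real)" where
  "proj_init c q p x = extend c p q (restr p x)"

text \<open>\<open>P\<^bsup>q\<^esup>\<^sub>E\<close> for a non-empty interval \<open>E\<close>: it is \<open>P\<^bsup>q\<^esup>\<^bsub>[0,s]\<^esub>\<close> if \<open>E = {0..s}\<close>, and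
  \<open>P\<^bsup>q\<^esup>\<^bsub>[0,s]\<^esub> - P\<^bsup>q\<^esup>\<^bsub>[0,p]\<^esub>\<close> if \<open>E = {p+1..s}\<close>.\<close>

definition proj ::
    "(node \<Rightarrow> (node \<Rightarrow> real) \<Rightarrow> real) \<Rightarrow> nat \<Rightarrow> nat set \<Rightarrow> (node \<Rightarrow> real) \<Rightarrow> (node \<Rightarrow> real)" where
  "proj c q E x =
     (\<lambda>\<eta>. proj_init c q (Max E) x \<eta> - (if 0 \<in> E then 0 else proj_init c q (Min E - 1) x \<eta>))"

definition weighted ::
    "(node \<Rightarrow> (node \<Rightarrow> real) \<Rightarrow> real) \<Rightarrow> nat \<Rightarrow> (int \<times> nat set \<times> node \<times> nat) list \<Rightarrow>
     (node \<Rightarrow> real) \<Rightarrow> real" where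
  "weighted c q ts x =
     \<theta> / real N * (1 / real (q + 1)) * (\<Sum>(\<epsilon>, E, \<eta>, h)\<leftarrow>ts. real h * of_int \<epsilon> * proj c q E x \<eta>)"

text \<open>\<open>cstar_upto q\<close> is the family of the functionals \<open>c\<^sup>*\<^sub>\<gamma>\<close> with \<open>1 \<le> rank(\<gamma>) \<le> q\<close>, built level by
  level.  The value at \<^term>\<open>Root\<close>, for which there is no functional, is a dummy.\<close>

primrec cstar_upto :: "nat \<Rightarrow> node \<Rightarrow> (node \<Rightarrow> real) \<Rightarrow> real" where
  "cstar_upto 0 = (\<lambda>\<gamma> x. 0)"
| "cstar_upto (Suc q) = (\<lambda>\<gamma> x.
     if node_rank \<gamma> = Suc q then
       (case \<gamma> of
          Root \<Rightarrow> 0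
        | NodeA _ ts \<Rightarrow> weighted (cstar_upto q) q ts x
        | NodeB _ \<xi> ts \<Rightarrow> x \<xi> + weighted (cstar_upto q) q ts x)
     else cstar_upto q \<gamma> x)"

definition cstar :: "node \<Rightarrow> (node \<Rightarrow> real) \<Rightarrow> real" where
  "cstar \<gamma> = cstar_upto (node_rank \<gamma>) \<gamma>"

definition extend_full :: "nat \<Rightarrow> (node \<Rightarrow> real) \<Rightarrow> (node \<Rightarrow> real)" where
  "extend_full p x =
     (\<lambda>\<gamma>. if \<gamma> \<in> Gamma_upto p then x \<gamma>
          else if \<gamma> \<in> Gamma_all then extend cstar p (node_rank \<gamma>) x \<gamma> else 0)"

definition d_vec :: "node \<Rightarrow> node \<Rightarrow>\<^sub>C real" where
  "d_vec \<gamma> = Bcontfun (extend_full (node_rank \<gamma>) (indicator {\<gamma>}))"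

definition BD_space :: "(node \<Rightarrow>\<^sub>C real) set" where
  "BD_space = closure (span (d_vec ` Gamma_all))"

subsection \<open>The functionals satisfy the intended recursion, and \<open>d\<^sub>\<gamma>\<close> is bounded\<close>

lemma node_rank_Delta: "\<gamma> \<in> Delta p \<Longrightarrow> node_rank \<gamma> = p"
  by (cases p) auto

lemma Gamma_Suc: "Gamma_upto (Suc q) = Gamma_upto q \<union> Delta (Suc q)"
  by (auto simp: Gamma_upto_def atMost_Suc simp del: Delta.simps)

lemma Gamma_mono: "p \<le> q \<Longrightarrow> Gamma_upto p \<subseteq> Gamma_upto q"
  by (force simp: Gamma_upto_def)

lemma Gamma_iff: "\<gamma> \<in> Gamma_upto q \<longleftrightarrow> \<gamma> \<in> Gamma_all \<and> node_rank \<gamma> \<le> q"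
  by (auto simp: Gamma_upto_def Gamma_all_def dest: node_rank_Delta)

lemma extend_cong:
  assumes "\<And>\<gamma>. node_rank \<gamma> \<le> q \<Longrightarrow> c \<gamma> = c' \<gamma>"
  shows "extend c p q x = extend c' p q x"
  using assms
proof (induction q)
  case (Suc q)
  then have "extend c p q x = extend c' p q x" by simp
  moreover have "c \<gamma> = c' \<gamma>" if "\<gamma> \<in> Delta (Suc q)" for \<gamma>
    using Suc.prems node_rank_Delta[OF that] by simp
  ultimately have "extend_step c q (extend c p q x) = extend_step c' q (extend c' p q x)"
    unfolding extend_step_def by (intro ext) (simp del: Delta.simps)
  then show ?case by simp
qed simp

lemma cstar_upto_eq: "node_rank \<gamma> \<le> q \<Longrightarrow> cstar_upto q \<gamma> = cstar \<gamma>"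
proof (induction q)
  case (Suc q)
  then show ?case
    by (cases "node_rank \<gamma> = Suc q") (auto simp: cstar_def)
qed (auto simp: cstar_def)

lemma weighted_cstar: "weighted (cstar_upto q) q ts x = weighted cstar q ts x"
proof -
  have "proj_init (cstar_upto q) q p y = proj_init cstar q p y" for p y
    unfolding proj_init_def by (rule extend_cong) (rule cstar_upto_eq)
  then show ?thesis
    by (simp add: weighted_def proj_def cong: if_cong)
qed

lemma cstar_NodeA: "cstar (NodeA (Suc q) ts) x = weighted cstar q ts x"
  by (simp add: cstar_def weighted_cstar)

lemma cstar_NodeB: "cstar (NodeB (Suc q) \<xi> ts) x = x \<xi> + weighted cstar q ts x"
  by (simp add: cstar_def weighted_cstar)

lemma extend_self: "extend c p p x = x"
  by (cases p) auto

lemma extend_restricts: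
  assumes "p \<le> q" "\<gamma> \<in> Gamma_upto p"
  shows "extend c p q x \<gamma> = x \<gamma>"
  using assms
proof (induction q)
  case (Suc q)
  show ?case
  proof (cases "p \<le> q")
    case True
    then show ?thesis
      using Suc Gamma_mono[of p q] by (auto simp: extend_step_def)
  qed (use Suc in auto)
qed simp

lemma extend_support:
  assumes "p \<le> q" "\<And>\<gamma>. \<gamma> \<notin> Gamma_upto p \<Longrightarrow> x \<gamma> = 0" "\<gamma> \<notin> Gamma_upto q"
  shows "extend c p q x \<gamma> = 0"
proof (cases q)
  case (Suc r)
  then have "\<gamma> \<notin> Gamma_upto r" "\<gamma> \<notin> Delta (Suc r)"
    using assms(3) by (simp_all add: Gamma_Suc del: Delta.simps)
  moreover have "x \<gamma> = 0" if "\<not> p \<le> r"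
  proof -
    have "p = q" using that assms(1) Suc by simp
    then show ?thesis using assms(2,3) by blast
  qed
  ultimately show ?thesis
    using Suc by (simp add: extend_step_def del: Delta.simps)
qed (use assms in auto)

lemma extend_extend:
  assumes "p \<le> s" "s \<le> q"
  shows "extend c s q (extend c p s x) = extend c p q x"
  using assms(2,1)
proof (induction q)
  case (Suc q)
  then show ?case
    by (cases "s \<le> q") (auto simp: le_Suc_eq extend_step_def)
qed auto

lemma restr_ext:
  assumes "p \<le> s" "s \<le> q" "\<And>\<gamma>. \<gamma> \<notin> Gamma_upto p \<Longrightarrow> x \<gamma> = 0"
  shows "restr s (extend c p q x) = extend c p s x"
proof
  fix \<gamma>
  show "restr s (extend c p q x) \<gamma> = extend c p s x \<gamma>"
    using extend_restricts[OF assms(2), of \<gamma> c "extend c p s x"] extend_support[OF assms(1), of x \<gamma> c] assms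
    by (auto simp: restr_def extend_extend)
qed

lemma extend_bound:
  assumes N: "real N > 0" and \<theta>: "0 < \<theta>" "2 * \<theta> < real N"
    and "p \<le> q" "\<And>\<gamma>. \<gamma> \<notin> Gamma_upto p \<Longrightarrow> x \<gamma> = 0" "\<And>\<gamma>. \<bar>x \<gamma>\<bar> \<le> B" "0 \<le> B"
  shows "\<bar>extend cstar p q x \<gamma>\<bar> \<le> real N / (real N - 2 * \<theta>) * B"
  using assms(4-)
proof (induction q arbitrary: p x \<gamma>)
  case 0
  have "1 \<le> real N / (real N - 2 * \<theta>)"
    using \<theta> by (simp add: field_simps)
  then have "1 * B \<le> real N / (real N - 2 * \<theta>) * B"
    using \<open>0 \<le> B\<close> by (rule mult_right_mono)
  then show ?case
    using 0(3)[of \<gamma>] by simp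
next
  case (Suc q)
  define C where "C = real N / (real N - 2 * \<theta>)"
  have C: "C = 1 + 2 * \<theta> / real N * C" "1 \<le> C"
    using \<theta> N by (auto simp: C_def field_simps)
  have CB: "B \<le> C * B"
    using C(2) \<open>0 \<le> B\<close> by (metis mult.left_neutral mult_right_mono)
  have CB2: "B + 2 * \<theta> / real N * (C * B) = C * B"
  proof -
    have "B + 2 * \<theta> / real N * (C * B) = (1 + 2 * \<theta> / real N * C) * B"
      by (simp add: algebra_simps)
    then show ?thesis
      using C(1) by simp
  qed
  show ?case
  proof (cases "p \<le> q")
    case False
    then show ?thesis
      using Suc.prems CB order_trans[of "\<bar>x \<gamma>\<bar>" B "C * B"] by (simp add: C_def)
  next
    case True
    define y where "y = extend cstar p q x"
    have y: "\<bar>y \<eta>\<bar> \<le> C * B" for \<eta>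
      unfolding y_def C_def using Suc.IH[OF True Suc.prems(2,3)] \<open>0 \<le> B\<close> by auto
    have y_x: "y \<eta> = x \<eta>" if "\<eta> \<in> Gamma_upto p" for \<eta>
      unfolding y_def using extend_restricts[OF True that] .
    have init_eq: "proj_init cstar q s y = y" if "p \<le> s" "s \<le> q" for s
      unfolding proj_init_def y_def
      using restr_ext[OF that Suc.prems(2)] extend_extend[OF that] by simp
    have init: "\<bar>proj_init cstar q s y \<eta>\<bar> \<le> C * B" if "s \<le> q" for s \<eta>
    proof (cases "p \<le> s")
      case True
      then show ?thesis
        using init_eq[OF True that] y by simp
    next
      case False
      then have "restr s y \<beta> = restr s x \<beta>" for \<beta>
        using y_x Gamma_mono[of s p] by (auto simp: restr_def)
      then have "restr s y = restr s x" by blast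
      moreover have "\<bar>restr s x \<beta>\<bar> \<le> B" for \<beta>
        using Suc.prems(3)[of \<beta>] \<open>0 \<le> B\<close> by (simp add: restr_def)
      ultimately show ?thesis
        unfolding proj_init_def C_def using that \<open>0 \<le> B\<close>
        by (intro Suc.IH) (auto simp: restr_def)
    qed
    have E: "Max E \<le> q" "E \<subseteq> {m..q} \<Longrightarrow> 0 < m \<Longrightarrow> 0 \<notin> E \<and> m - 1 \<le> Min E - 1 \<and> Min E - 1 \<le> Max E"
      if "interval E" "E \<subseteq> {0..q}" for E m
    proof -
      from that obtain a b where ab: "a \<le> b" "E = {a..b}" by (auto simp: interval_def)
      then have MM: "Max E = b" "Min E = a"
        by (auto intro: Max_eqI Min_eqI)
      show "Max E \<le> q" using that ab MM by auto
      show "0 \<notin> E \<and> m - 1 \<le> Min E - 1 \<and> Min E - 1 \<le> Max E" if "E \<subseteq> {m..q}" "0 < m"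
      proof -
        have "m \<le> a" using that ab by auto
        then show ?thesis using MM ab \<open>0 < m\<close> by auto
      qed
    qed
    have Emin: "Min E - 1 \<le> q" if "interval E" "E \<subseteq> {0..q}" for E
    proof -
      from that obtain a b where "a \<le> b" "E = {a..b}" by (auto simp: interval_def)
      moreover from this have "Min E = a" by (auto intro: Min_eqI)
      ultimately show ?thesis using that by auto
    qed
    have proj: "\<bar>proj cstar q E y \<eta>\<bar> \<le> 2 * (C * B)" if "interval E" "E \<subseteq> {0..q}" for E \<eta>
      using init[OF E(1)[OF that], of \<eta>] init[OF Emin[OF that], of \<eta>] CB \<open>0 \<le> B\<close>
      by (auto simp: proj_def)
    have proj0: "proj cstar q E y \<eta> = 0"
      if "interval E" "E \<subseteq> {m + 1..q}" "p \<le> m" for E \<eta> m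
    proof -
      have "E \<subseteq> {0..q}" using that by auto
      note E1 = E(1)[OF that(1) this] and E2 = E(2)[OF that(1) this that(2)]
      have "p \<le> Min E - 1" "Min E - 1 \<le> Max E" "0 \<notin> E" using E2 that by auto
      then show ?thesis
        using E1 by (simp add: proj_def init_eq)
    qed
    have weighted: "\<bar>weighted cstar q ts y\<bar> \<le> 2 * \<theta> / real N * (C * B)"
      if adm: "admissible q J G ts" "J \<subseteq> {0..q}" for J G ts
    proof -
      have 1: "\<bar>\<Sum>(\<epsilon>, E, \<eta>, h)\<leftarrow>ts. real h * of_int \<epsilon> * proj cstar q E y \<eta>\<bar>
               \<le> real (\<Sum>(\<epsilon>, E, \<eta>, h)\<leftarrow>ts. h) * (2 * (C * B))"
        if "\<forall>(\<epsilon>, E, \<eta>, h) \<in> set ts. \<epsilon> \<in> {-1, 1} \<and> interval E \<and> E \<subseteq> {0..q}" for ts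
        using that
      proof (induction ts)
        case (Cons t ts)
        obtain \<epsilon> E \<eta> h where t: "t = (\<epsilon>, E, \<eta>, h)" by (cases t) auto
        have "\<bar>real h * of_int \<epsilon> * proj cstar q E y \<eta>\<bar> \<le> real h * (2 * (C * B))"
          using Cons.prems proj[of E \<eta>] t by (auto simp: abs_mult intro!: mult_left_mono)
        with Cons show ?case
          unfolding t by (auto simp: algebra_simps)
      qed simp
      have "\<bar>\<Sum>(\<epsilon>, E, \<eta>, h)\<leftarrow>ts. real h * of_int \<epsilon> * proj cstar q E y \<eta>\<bar>
            \<le> real (\<Sum>(\<epsilon>, E, \<eta>, h)\<leftarrow>ts. h) * (2 * (C * B))"
        using adm by (intro 1) (fastforce simp: admissible_def)
      also have "\<dots> \<le> real (q + 1) * (2 * (C * B))"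
        using adm CB \<open>0 \<le> B\<close> by (intro mult_right_mono) (auto simp: admissible_def)
      finally have "\<theta> / real N * (1 / real (q + 1)) *
          \<bar>\<Sum>(\<epsilon>, E, \<eta>, h)\<leftarrow>ts. real h * of_int \<epsilon> * proj cstar q E y \<eta>\<bar>
          \<le> \<theta> / real N * (1 / real (q + 1)) * (real (q + 1) * (2 * (C * B)))"
        using \<theta> N by (intro mult_left_mono) auto
      also have "\<dots> = 2 * \<theta> / real N * (C * B)"
        by simp
      finally show ?thesis
        using \<theta> N by (simp add: weighted_def abs_mult)
    qed
    have "\<bar>extend_step cstar q y \<gamma>\<bar> \<le> C * B"
    proof (cases "\<gamma> \<notin> Gamma_upto q \<and> \<gamma> \<in> Delta (Suc q)")
      case False
      then show ?thesis
        using y CB \<open>0 \<le> B\<close> by (auto simp: extend_step_def)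
    next
      case True
      then have eq: "extend_step cstar q y \<gamma> = cstar \<gamma> y" by (simp add: extend_step_def)
      consider ts where "\<gamma> = NodeA (Suc q) ts" "admissible q {0..q} (\<Union>i\<in>{..q}. Delta i) ts"
        | \<xi> ts where "\<gamma> = NodeB (Suc q) \<xi> ts" "\<xi> \<in> (\<Union>i\<in>{..q - 1}. Delta i)"
            "admissible q {node_rank \<xi> + 1..q} (\<Union>i\<in>{..q}. Delta i) ts"
        using True by auto
      then show ?thesis
      proof cases
        case 1
        then show ?thesis
          using weighted[OF 1(2)] CB2 \<open>0 \<le> B\<close> unfolding eq by (simp add: 1(1) cstar_NodeA)
      next
        case 2
        note w = weighted[OF 2(3)]
        show ?thesis
        proof (cases "node_rank \<xi> \<le> p")
          case True
          have "\<xi> \<in> Gamma_upto p"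
            using 2(2) True by (auto simp: Gamma_iff Gamma_all_def)
          then have "\<bar>y \<xi>\<bar> \<le> B"
            using y_x Suc.prems(3) by simp
          then show ?thesis
            using w CB2 unfolding eq by (simp add: 2(1) cstar_NodeB)
        next
          case False
          have "\<forall>(\<epsilon>, E, \<eta>, h) \<in> set ts. proj cstar q E y \<eta> = 0"
            using 2(3) False proj0[of _ "node_rank \<xi>"] by (fastforce simp: admissible_def)
          then have "(\<Sum>(\<epsilon>, E, \<eta>, h)\<leftarrow>ts. real h * of_int \<epsilon> * proj cstar q E y \<eta>) = 0"
            by (induction ts) auto
          then have "weighted cstar q ts y = 0"
            by (simp add: weighted_def)
          then show ?thesis
            using y unfolding eq by (simp add: 2(1) cstar_NodeB)
        qed
      qed
    qed
    then show ?thesis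
      using True by (simp add: C_def y_def)
  qed
qed

lemma apply_d_vec:
  assumes "2 * \<theta> < real N" "0 < \<theta>" "\<gamma> \<in> Gamma_all"
  shows "apply_bcontfun (d_vec \<gamma>) = extend_full (node_rank \<gamma>) (indicator {\<gamma>})"
proof -
  define C where "C = real N / (real N - 2 * \<theta>)"
  have "1 \<le> C" using assms by (simp add: C_def field_simps)
  have \<gamma>: "\<gamma> \<in> Gamma_upto (node_rank \<gamma>)" using assms(3) by (simp add: Gamma_iff)
  have "\<bar>extend_full (node_rank \<gamma>) (indicator {\<gamma>}) \<beta>\<bar> \<le> C" for \<beta>
  proof -
    have "\<bar>extend cstar (node_rank \<gamma>) (node_rank \<beta>) (indicator {\<gamma>}) \<beta>\<bar> \<le> C * 1" if "node_rank \<gamma> \<le> node_rank \<beta>"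
      unfolding C_def using assms \<gamma> that
      by (intro extend_bound) (auto simp: indicator_def)
    then show ?thesis
      using \<open>1 \<le> C\<close> by (auto simp: extend_full_def Gamma_iff indicator_def)
  qed
  then have "extend_full (node_rank \<gamma>) (indicator {\<gamma>}) \<in> bcontfun"
    by (auto simp: bcontfun_def bounded_iff intro!: exI[of _ C])
  then show ?thesis
    by (simp add: d_vec_def Bcontfun_inverse)
qed

end

text \<open>So the argument of \<^const>\<open>Bcontfun\<close> in the definition of \<^const>\<open>d_vec\<close> is a bounded function.\<close>

section \<open>Isomorphisms and \<open>c\<^sub>0\<close>\<close>

definition c0 :: "(nat \<Rightarrow>\<^sub>C real) set" where
  "c0 = {x. apply_bcontfun x \<longlonglongrightarrow> 0}"

definition isomorphic_subspaces ::
    "'a::real_normed_vector set \<Rightarrow> 'b::real_normed_vector set \<Rightarrow> bool" where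
  "isomorphic_subspaces S T \<longleftrightarrow>
     (\<exists>f g. (\<forall>x\<in>S. \<forall>y\<in>S. f (x + y) = f x + f y) \<and>
            (\<forall>r. \<forall>x\<in>S. f (r *\<^sub>R x) = r *\<^sub>R f x) \<and>
            homeomorphism S T f g)"

definition contains_copy ::
    "'a::real_normed_vector set \<Rightarrow> 'b::real_normed_vector set \<Rightarrow> bool" where
  "contains_copy X T \<longleftrightarrow> (\<exists>Y. subspace Y \<and> Y \<subseteq> X \<and> isomorphic_subspaces Y T)"

text \<open>The topology of \<open>{0,1}\<^sup>\<nat>\<close> is the product topology on \<open>nat \<Rightarrow> bool\<close>.  Here \<open>\<nat> = {1, 2, \<dots>}\<close>; the
  additional coordinate \<open>0\<close> of the functions below is constantly \<^term>\<open>False\<close>.\<close>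

definition compact_family :: "nat set set \<Rightarrow> bool" where
  "compact_family \<M> \<longleftrightarrow> \<M> \<subseteq> Pow {1..} \<and> compact ((\<lambda>A n. n \<in> A) ` \<M>)"

end

theory Submission
  imports Defs
begin

text \<open>
  Evaluating a vector at a node of age \<open>n\<close> unfolds into \<open>n\<close> coordinates and \<open>n\<close> weighted averages of
  interval projections, each average having the factor \<open>\<theta> / N\<close>.

  (1) Let \<open>A \<in> \<M>\<close> be infinite. It cuts the ranks into finite blocks, and each block of the decomposition is
  uniformly isomorphic to a finite-dimensional \<open>\<ell>\<^sub>\<infinity>\<close>. In every average the intervals meeting \<open>A\<close> have weight
  less than \<open>\<omega>\<close>, and the others lie inside a single block. Since there are at most \<open>N\<close> averages, a bound \<open>K\<close> on
  vectors whose block components have norm at most \<open>1\<close> reproduces itself as a constant plus \<open>\<theta> \<omega> K\<close>, with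
  \<open>\<theta> \<omega> < 1\<close>. So the blocks form a \<open>c\<^sub>0\<close>-sum.

  (2) If \<open>\<M>\<close> is compact and consists of finite sets, Ptak's lemma gives averages over any sequence of disjoint
  intervals whose weight on every set of \<open>\<M>\<close> is below \<open>\<omega>\<close>. A copy of \<open>c\<^sub>0\<close> yields, by a gliding hump, blocks
  with values at least \<open>c > 0\<close> at some node and uniformly bounded finite sums. From such blocks, \<open>N\<close> successive
  averages build a node at which a finite sum is at least \<open>\<theta> c\<close>. As \<open>\<theta> > 1\<close>, iteration contradicts boundedness.
\<close>

section \<open>Partial-sum projections\<close>

lemma sum_list_quad_cong:
  assumes "\<And>\<epsilon> E \<eta> h. (\<epsilon>, E, \<eta>, h) \<in> set ts \<Longrightarrow> f \<epsilon> E \<eta> h = g \<epsilon> E \<eta> h"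
  shows "(\<Sum>(\<epsilon>, E, \<eta>, h)\<leftarrow>ts. f \<epsilon> E \<eta> h) = (\<Sum>(\<epsilon>, E, \<eta>, h)\<leftarrow>ts. g \<epsilon> E \<eta> h)"
  using assms by (induction ts) auto

section \<open>Linearity of the functionals \<open>cstar\<close>\<close>

definition lin_comb :: "real \<Rightarrow> real \<Rightarrow> ('a \<Rightarrow> real) \<Rightarrow> ('a \<Rightarrow> real) \<Rightarrow> 'a \<Rightarrow> real" where
  "lin_comb a b x y = (\<lambda>t. a * x t + b * y t)"

definition lin_fun :: "(('a \<Rightarrow> real) \<Rightarrow> real) \<Rightarrow> bool" where
  "lin_fun \<phi> \<longleftrightarrow> (\<forall>a b x y. \<phi> (lin_comb a b x y) = a * \<phi> x + b * \<phi> y)"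

lemma restr_lin_comb: "restr N \<omega> \<M> p (lin_comb a b x y) = lin_comb a b (restr N \<omega> \<M> p x) (restr N \<omega> \<M> p y)"
  by (auto simp: restr_def lin_comb_def)

lemma extend_lin_comb:
  assumes "\<And>\<gamma>. lin_fun (c \<gamma>)"
  shows "extend N \<omega> \<M> c p q (lin_comb a b x y) =
    lin_comb a b (extend N \<omega> \<M> c p q x) (extend N \<omega> \<M> c p q y)"
proof (induction q)
  case (Suc q)
  have "extend_step N \<omega> \<M> c q (lin_comb a b u v) =
      lin_comb a b (extend_step N \<omega> \<M> c q u) (extend_step N \<omega> \<M> c q v)" for u v
    using assms by (auto simp: extend_step_def lin_fun_def lin_comb_def fun_eq_iff simp del: Delta.simps)
  then show ?case using Suc by simp
qed simp

lemma weighted_lin: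
  assumes "\<And>\<gamma>. lin_fun (c \<gamma>)"
  shows "lin_fun (weighted N \<theta> \<omega> \<M> c q ts)"
proof -
  have p: "proj N \<omega> \<M> c q E (lin_comb a b x y) \<eta> = a * proj N \<omega> \<M> c q E x \<eta> + b * proj N \<omega> \<M> c q E y \<eta>"
    for E a b x y \<eta>
    by (simp add: proj_def proj_init_def restr_lin_comb extend_lin_comb[OF assms])
       (simp add: lin_comb_def algebra_simps)
  have "(\<Sum>(\<epsilon>, E, \<eta>, h)\<leftarrow>ts. real h * of_int \<epsilon> * proj N \<omega> \<M> c q E (lin_comb a b x y) \<eta>) =
    a * (\<Sum>(\<epsilon>, E, \<eta>, h)\<leftarrow>ts. real h * of_int \<epsilon> * proj N \<omega> \<M> c q E x \<eta>) +
    b * (\<Sum>(\<epsilon>, E, \<eta>, h)\<leftarrow>ts. real h * of_int \<epsilon> * proj N \<omega> \<M> c q E y \<eta>)" for a b x y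
    unfolding p by (induction ts) (auto simp: algebra_simps)
  then show ?thesis
    unfolding lin_fun_def weighted_def by (simp add: algebra_simps)
qed

text \<open>Induction on the level: the functionals of level \<open>Suc q\<close> are averages of
  projections built from those of levels up to \<open>q\<close>, plus possibly a point evaluation,
  and both operations preserve linearity.\<close>

lemma cstar_lin: "lin_fun (cstar N \<theta> \<omega> \<M> \<gamma>)"
proof -
  have "lin_fun (cstar_upto N \<theta> \<omega> \<M> q \<gamma>)" for q \<gamma>
  proof (induction q arbitrary: \<gamma>)
    case 0
    then show ?case by (simp add: lin_fun_def)
  next
    case (Suc q)
    have "lin_fun (weighted N \<theta> \<omega> \<M> (cstar_upto N \<theta> \<omega> \<M> q) q ts)" for ts
      by (rule weighted_lin) (rule Suc)
    then show ?case
      using Suc by (cases \<gamma>) (auto simp: lin_fun_def lin_comb_def algebra_simps)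
  qed
  then show ?thesis by (simp add: cstar_def)
qed

lemma subspace_closure:
  fixes S :: "'a::real_normed_vector set"
  assumes "subspace S"
  shows "subspace (closure S)"
proof (rule subspaceI)
  show "0 \<in> closure S" using subspace_0[OF assms] closure_subset by blast
next
  fix x y assume "x \<in> closure S" "y \<in> closure S"
  then obtain f g where "\<forall>n. f n \<in> S" "f \<longlonglongrightarrow> x" "\<forall>n. g n \<in> S" "g \<longlonglongrightarrow> y"
    unfolding closure_sequential by blast
  then show "x + y \<in> closure S"
    unfolding closure_sequential using subspace_add[OF assms]
    by (intro exI[of _ "\<lambda>n. f n + g n"]) (auto intro: tendsto_add)
next
  fix c x assume "x \<in> closure S"
  then obtain f where "\<forall>n. f n \<in> S" "f \<longlonglongrightarrow> x"
    unfolding closure_sequential by blast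
  then show "c *\<^sub>R x \<in> closure S"
    unfolding closure_sequential using subspace_scale[OF assms]
    by (intro exI[of _ "\<lambda>n. c *\<^sub>R f n"]) (auto intro: tendsto_scaleR)
qed

lemma apply_sum: "apply_bcontfun (\<Sum>k\<in>F. f k) \<gamma> = (\<Sum>k\<in>F. apply_bcontfun (f k) \<gamma>)"
  for f :: "'k \<Rightarrow> 'a::topological_space \<Rightarrow>\<^sub>C 'b::real_normed_vector"
  by (induction F rule: infinite_finite_induct) auto

section \<open>The projections \<open>J\<close> and the recursion satisfied by their values\<close>

locale bd_param =
  fixes N :: nat and \<theta> \<omega> :: real and \<M> :: "nat set set"
  assumes \<theta>_pos: "0 < \<theta>" and \<theta>_less: "2 * \<theta> < real N"
begin

abbreviation "\<Gamma> \<equiv> Gamma_all N \<omega> \<M>"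
abbreviation "\<Delta> \<equiv> Delta N \<omega> \<M>"
abbreviation "\<Gamma>upto \<equiv> Gamma_upto N \<omega> \<M>"
abbreviation "cst \<equiv> cstar N \<theta> \<omega> \<M>"
abbreviation "adm \<equiv> admissible \<omega> \<M>"

text \<open>\<open>J n\<close> is the projection \<open>P\<^bsub>[0,n)\<^esub>\<close>; with the half-open convention \<open>P\<^bsub>[a,b]\<^esub> = J (b + 1) - J a\<close>
  also for \<open>a = 0\<close>.\<close>

definition J :: "nat \<Rightarrow> (node \<Rightarrow> real) \<Rightarrow> node \<Rightarrow> real" where
  "J n x = (if n = 0 then (\<lambda>_. 0) else extend_full N \<theta> \<omega> \<M> (n - 1) (restr N \<omega> \<M> (n - 1) x))"

definition PE :: "nat set \<Rightarrow> (node \<Rightarrow> real) \<Rightarrow> node \<Rightarrow> real" where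
  "PE E x = (\<lambda>\<gamma>. J (Suc (Max E)) x \<gamma> - J (Min E) x \<gamma>)"

text \<open>The average of \<open>weighted\<close>, with the projections \<open>PE\<close> on the
  whole of \<Gamma> in place of those of level \<open>q\<close>; \<open>weighted_W\<close>
  identifies the two.\<close>

definition W :: "nat \<Rightarrow> (int \<times> nat set \<times> node \<times> nat) list \<Rightarrow> (node \<Rightarrow> real) \<Rightarrow> real" where
  "W q ts x = \<theta> / real N * (1 / real (q + 1)) * (\<Sum>(\<epsilon>, E, \<eta>, h)\<leftarrow>ts. real h * of_int \<epsilon> * PE E x \<eta>)"

lemma N_pos: "0 < real N"
  using \<theta>_pos \<theta>_less by linarith

lemma Delta_subset: "\<gamma> \<in> \<Delta> p \<Longrightarrow> \<gamma> \<in> \<Gamma>"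
  by (auto simp: Gamma_all_def)

lemma in_Delta: "\<gamma> \<in> \<Gamma> \<Longrightarrow> \<gamma> \<in> \<Delta> (node_rank \<gamma>)"
  by (auto simp: Gamma_all_def simp del: Delta.simps dest: node_rank_Delta)

lemma Root_iff: "\<gamma> \<in> \<Gamma> \<Longrightarrow> node_rank \<gamma> = 0 \<longleftrightarrow> \<gamma> = Root"
  using in_Delta by force

lemma J_outside: "\<gamma> \<notin> \<Gamma> \<Longrightarrow> J n x \<gamma> = 0"
  by (simp add: J_def extend_full_def Gamma_iff)

lemma J_below: "\<gamma> \<in> \<Gamma> \<Longrightarrow> node_rank \<gamma> < n \<Longrightarrow> J n x \<gamma> = x \<gamma>"
  by (auto simp: J_def extend_full_def restr_def Gamma_iff)

lemma J_cong:
  assumes "\<And>\<gamma>. \<gamma> \<in> \<Gamma> \<Longrightarrow> node_rank \<gamma> < n \<Longrightarrow> x \<gamma> = y \<gamma>"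
  shows "J n x = J n y"
proof (cases n)
  case (Suc m)
  have "restr N \<omega> \<M> m x = restr N \<omega> \<M> m y"
    using assms Suc by (auto simp: restr_def Gamma_iff)
  then show ?thesis by (simp add: J_def Suc)
qed (simp add: J_def)

text \<open>Later extension steps leave values at earlier ranks unchanged, so any level that
  contains \<gamma> computes the value there.\<close>

lemma J_extend:
  assumes "p \<le> q" "\<gamma> \<in> \<Gamma>upto q"
  shows "J (Suc p) x \<gamma> = extend N \<omega> \<M> cst p q (restr N \<omega> \<M> p x) \<gamma>"
proof (cases "node_rank \<gamma> \<le> p")
  case True
  then have "\<gamma> \<in> \<Gamma>upto p" using assms by (simp add: Gamma_iff)
  then show ?thesis
    using extend_restricts[OF assms(1)] by (simp add: J_def extend_full_def)
next
  case False
  have g: "\<gamma> \<in> \<Gamma>" "node_rank \<gamma> \<le> q" using assms by (auto simp: Gamma_iff)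
  have 1: "extend N \<omega> \<M> cst p q y \<gamma> = extend N \<omega> \<M> cst p (node_rank \<gamma>) y \<gamma>" for y
    using extend_extend[of p "node_rank \<gamma>" q] extend_restricts[of "node_rank \<gamma>" q \<gamma>] False g
    by (metis Gamma_iff nle_le)
  show ?thesis
    using False g by (simp add: J_def extend_full_def 1 Gamma_iff)
qed

lemma interval_MinMax:
  assumes "interval E"
  obtains "finite E" "E \<noteq> {}" "E = {Min E..Max E}" "Min E \<le> Max E"
proof -
  obtain a b where "a \<le> b" "E = {a..b}" using assms by (auto simp: interval_def)
  moreover from this have "Max E = b" "Min E = a"
    by (auto intro: Max_eqI Min_eqI)
  ultimately show ?thesis using that by auto
qed

lemma interval_bounds:
  assumes "interval E" "E \<subseteq> {l..q}"
  shows "l \<le> Min E" "Min E \<le> Max E" "Max E \<le> q" "Min E \<le> q"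
proof -
  obtain a b where ab: "a \<le> b" "E = {a..b}" using assms by (auto simp: interval_def)
  then have "Max E = b" "Min E = a"
    by (auto intro: Max_eqI Min_eqI)
  with ab assms(2) show "l \<le> Min E" "Min E \<le> Max E" "Max E \<le> q" "Min E \<le> q" by auto
qed

text \<open>The case distinction of \<open>proj\<close> on whether \<open>0\<close> lies in
  \<open>E\<close> disappears, because \<open>J 0\<close> is the zero operator; otherwise
  \<open>Suc (Min E - 1)\<close> equals \<open>Min E\<close>.\<close>

lemma proj_PE:
  assumes "interval E" "E \<subseteq> {0..q}" "\<eta> \<in> \<Gamma>upto q"
  shows "proj N \<omega> \<M> cst q E x \<eta> = PE E x \<eta>"
proof -
  obtain fin: "finite E" "E \<noteq> {}" and E: "E = {Min E..Max E}" "Min E \<le> Max E"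
    using interval_MinMax[OF assms(1)] by blast
  have b: "Max E \<le> q" "Min E \<le> q" using interval_bounds[OF assms(1,2)] by auto
  have "0 \<in> E \<longleftrightarrow> Min E = 0" using fin E by (metis Min_in Min_le le_zero_eq)
  then show ?thesis
    using J_extend[of "Max E" q \<eta> x] J_extend[of "Min E - 1" q \<eta> x] b assms(3)
    by (auto simp: proj_def proj_init_def PE_def J_def[of 0])
qed

lemma adm_elem:
  assumes "adm q I G ts" "(\<epsilon>, E, \<eta>, h) \<in> set ts"
  shows "\<epsilon> \<in> {-1, 1}" "interval E" "E \<subseteq> I" "\<eta> \<in> G"
proof -
  have "\<forall>t\<in>set ts. case t of (\<epsilon>, E, \<eta>, h) \<Rightarrow> \<epsilon> \<in> {-1, 1} \<and> interval E \<and> E \<subseteq> I \<and> \<eta> \<in> G"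
    using assms(1) unfolding admissible_def by (elim conjE)
  from bspec[OF this assms(2)]
  show "\<epsilon> \<in> {-1, 1}" "interval E" "E \<subseteq> I" "\<eta> \<in> G" by simp_all
qed

lemma weighted_W:
  assumes "adm q I (\<Gamma>upto q) ts" "I \<subseteq> {0..q}"
  shows "weighted N \<theta> \<omega> \<M> cst q ts x = W q ts x"
proof -
  have "(\<Sum>(\<epsilon>, E, \<eta>, h)\<leftarrow>ts. real h * of_int \<epsilon> * proj N \<omega> \<M> cst q E x \<eta>) =
        (\<Sum>(\<epsilon>, E, \<eta>, h)\<leftarrow>ts. real h * of_int \<epsilon> * PE E x \<eta>)"
  proof (rule sum_list_quad_cong)
    fix \<epsilon> E \<eta> h assume "(\<epsilon>, E, \<eta>, h) \<in> set ts"
    note t = adm_elem[OF assms(1) this]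
    then show "real h * of_int \<epsilon> * proj N \<omega> \<M> cst q E x \<eta> = real h * of_int \<epsilon> * PE E x \<eta>"
      using proj_PE[of E q \<eta>] assms(2) by simp
  qed
  then show ?thesis by (simp add: weighted_def W_def)
qed

text \<open>The form in which nodes are analysed from here on: levels are expressed by ranks and the
  functionals by \<open>W\<close>. In form (b), membership of \<xi> in level \<open>q - 1\<close>
  with \<open>2 \<le> q\<close> becomes \<open>node_rank \<xi> < q\<close>.\<close>

lemma node_cases:
  assumes "\<gamma> \<in> \<Gamma>"
  obtains (Root) "\<gamma> = Root"
  | (A) q ts where "\<gamma> = NodeA (Suc q) ts" "adm q {0..q} (\<Gamma>upto q) ts"
      "\<And>x. cst \<gamma> x = W q ts x"
  | (B) q \<xi> ts where "\<gamma> = NodeB (Suc q) \<xi> ts" "\<xi> \<in> \<Gamma>" "0 < node_rank \<xi>" "node_rank \<xi> < q" "age \<xi> < N"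
      "adm q {node_rank \<xi> + 1..q} (\<Gamma>upto q) ts" "\<And>x. cst \<gamma> x = x \<xi> + W q ts x"
proof (cases "node_rank \<gamma>")
  case 0
  then show ?thesis using Root Root_iff[OF assms] by blast
next
  case (Suc q)
  have "\<gamma> \<in> \<Delta> (Suc q)" using in_Delta[OF assms] Suc by simp
  then consider ts where "\<gamma> = NodeA (Suc q) ts" "adm q {0..q} (\<Gamma>upto q) ts"
    | \<xi> ts where "\<gamma> = NodeB (Suc q) \<xi> ts" "2 \<le> q" "\<xi> \<in> \<Gamma>upto (q - 1)" "\<xi> \<notin> \<Delta> 0" "age \<xi> < N"
      "adm q {node_rank \<xi> + 1..q} (\<Gamma>upto q) ts"
    by (auto simp: Gamma_upto_def)
  then show ?thesis
  proof cases
    case 1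
    then show ?thesis using A weighted_W[OF 1(2)] by (simp add: cstar_NodeA)
  next
    case 2
    then have "\<xi> \<in> \<Gamma>" "node_rank \<xi> \<le> q - 1" by (auto simp: Gamma_iff)
    moreover have "node_rank \<xi> \<noteq> 0" using 2(4) Root_iff[OF \<open>\<xi> \<in> \<Gamma>\<close>] by auto
    ultimately show ?thesis using B[of q \<xi> ts] 2 weighted_W[OF 2(6)] by (auto simp: cstar_NodeB)
  qed
qed

lemma NodeA_in: "adm q {0..q} (\<Gamma>upto q) ts \<Longrightarrow> NodeA (Suc q) ts \<in> \<Gamma>"
  by (rule Delta_subset[of _ "Suc q"]) (auto simp: Gamma_upto_def)

lemma NodeB_in:
  assumes "adm q {node_rank \<xi> + 1..q} (\<Gamma>upto q) ts" "\<xi> \<in> \<Gamma>" "0 < node_rank \<xi>" "node_rank \<xi> < q" "age \<xi> < N"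
  shows "NodeB (Suc q) \<xi> ts \<in> \<Gamma>"
proof -
  have "\<xi> \<in> \<Gamma>upto (q - 1)" using assms by (auto simp: Gamma_iff)
  moreover have "\<xi> \<notin> \<Delta> 0" using assms(3) by auto
  ultimately show ?thesis
    using assms by (intro Delta_subset[of _ "Suc q"]) (auto simp: Gamma_upto_def)
qed

lemma age_le: "\<gamma> \<in> \<Gamma> \<Longrightarrow> age \<gamma> \<le> N"
  by (cases \<gamma> rule: node_cases) (use N_pos in auto)

lemma W_cong:
  assumes "adm q I (\<Gamma>upto q) ts" "I \<subseteq> {0..q}" "\<And>\<gamma>. \<gamma> \<in> \<Gamma> \<Longrightarrow> node_rank \<gamma> \<le> q \<Longrightarrow> x \<gamma> = y \<gamma>"
  shows "W q ts x = W q ts y"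
proof -
  have "PE E x \<eta> = PE E y \<eta>" if "(\<epsilon>, E, \<eta>, h) \<in> set ts" for \<epsilon> E \<eta> h
  proof -
    have "interval E" "E \<subseteq> {0..q}" using adm_elem[OF assms(1) that] assms(2) by auto
    then have "Max E \<le> q" "Min E \<le> q"
      using interval_bounds by blast+
    then have "J (Suc (Max E)) x = J (Suc (Max E)) y" "J (Min E) x = J (Min E) y"
      by (auto intro!: J_cong assms(3))
    then show ?thesis by (simp add: PE_def)
  qed
  then have "(\<Sum>(\<epsilon>, E, \<eta>, h)\<leftarrow>ts. real h * of_int \<epsilon> * PE E x \<eta>) =
        (\<Sum>(\<epsilon>, E, \<eta>, h)\<leftarrow>ts. real h * of_int \<epsilon> * PE E y \<eta>)"
    by (intro sum_list_quad_cong) simp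
  then show ?thesis by (simp add: W_def)
qed

text \<open>Mathematically the functional of a node of rank q + 1 lives on the bounded functions on
  the nodes of rank at most q; here it is typed as acting on all functions, so this locality has to
  be recovered.\<close>

lemma cst_cong:
  assumes "\<gamma> \<in> \<Gamma>" "\<gamma> \<noteq> Root" "\<And>\<beta>. \<beta> \<in> \<Gamma> \<Longrightarrow> node_rank \<beta> < node_rank \<gamma> \<Longrightarrow> x \<beta> = y \<beta>"
  shows "cst \<gamma> x = cst \<gamma> y"
  using assms(1)
proof (cases \<gamma> rule: node_cases)
  case (A q ts)
  then show ?thesis using W_cong[OF A(2), of x y] assms(3) by simp
next
  case (B q \<xi> ts)
  then show ?thesis using W_cong[OF B(6), of x y] assms(3) by simp
qed (use assms in auto)

text \<open>From rank \<open>n\<close> on, a vector in the range of \<open>J n\<close> is generated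
  by the extension steps, and each functional sees only the lower ranks, where the finite-level
  extension agrees with \<open>J n x\<close>.\<close>

lemma J_above:
  assumes "\<gamma> \<in> \<Gamma>" "n \<le> node_rank \<gamma>" "\<gamma> \<noteq> Root"
  shows "J n x \<gamma> = cst \<gamma> (J n x)"
proof (cases n)
  case 0
  have "cst \<gamma> (lin_comb 0 0 (\<lambda>_. 0) (\<lambda>_. 0)) = 0" using cstar_lin by (simp add: lin_fun_def)
  then show ?thesis by (simp add: 0 J_def lin_comb_def)
next
  case (Suc p)
  obtain q where q: "node_rank \<gamma> = Suc q" using Suc assms by (cases "node_rank \<gamma>") auto
  have "\<gamma> \<in> \<Delta> (Suc q)" "\<gamma> \<notin> \<Gamma>upto q" "\<gamma> \<in> \<Gamma>upto (Suc q)" "p \<le> q"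
    using in_Delta[OF assms(1)] q Suc assms by (auto simp: Gamma_iff simp del: Delta.simps)
  then have "J n x \<gamma> = cst \<gamma> (extend N \<omega> \<M> cst p q (restr N \<omega> \<M> p x))"
    using J_extend[of p "Suc q" \<gamma> x] Suc by (simp add: extend_step_def del: Delta.simps)
  also have "\<dots> = cst \<gamma> (J n x)"
    using assms J_extend[OF \<open>p \<le> q\<close>] q Suc by (intro cst_cong) (auto simp: Gamma_iff)
  finally show ?thesis .
qed

text \<open>The recursion determines a vector by induction on the rank, so projections can be
  identified by checking the recursion instead of unfolding extensions. The last assumption fixes
  the value at \<open>Root\<close> when \<open>n = 0\<close>, where neither a prescribed value nor a
  functional is available.\<close>

lemma J_unique:
  assumes "\<And>\<gamma>. \<gamma> \<notin> \<Gamma> \<Longrightarrow> z \<gamma> = 0"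
    and "\<And>\<gamma>. \<gamma> \<in> \<Gamma> \<Longrightarrow> node_rank \<gamma> < n \<Longrightarrow> z \<gamma> = x \<gamma>"
    and "\<And>\<gamma>. \<gamma> \<in> \<Gamma> \<Longrightarrow> \<gamma> \<noteq> Root \<Longrightarrow> n \<le> node_rank \<gamma> \<Longrightarrow> z \<gamma> = cst \<gamma> z"
    and "n = 0 \<Longrightarrow> z Root = 0"
  shows "J n x = z"
proof
  fix \<gamma>
  show "J n x \<gamma> = z \<gamma>"
  proof (induction "node_rank \<gamma>" arbitrary: \<gamma> rule: less_induct)
    case less
    consider "\<gamma> \<notin> \<Gamma>" | "\<gamma> \<in> \<Gamma>" "node_rank \<gamma> < n" | "\<gamma> = Root" "n = 0"
      | "\<gamma> \<in> \<Gamma>" "\<gamma> \<noteq> Root" "n \<le> node_rank \<gamma>"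
      by (metis Root_iff leI le_zero_eq)
    then show ?case
    proof cases
      case 1
      then show ?thesis by (simp add: J_outside assms(1))
    next
      case 2
      then show ?thesis by (simp add: J_below assms(2))
    next
      case 3
      then show ?thesis by (simp add: J_def assms(4))
    next
      case 4
      then have "cst \<gamma> (J n x) = cst \<gamma> z" using less by (intro cst_cong) auto
      then show ?thesis using J_above[of \<gamma> n x] assms(3)[of \<gamma>] 4 by simp
    qed
  qed
qed

text \<open>If \<open>m \<le> n\<close>, then \<open>J n\<close> keeps all values that
  \<open>J m\<close> reads; otherwise \<open>J n x\<close> already satisfies the recursion from rank
  \<open>m\<close> on.\<close>

lemma J_J: "J m (J n x) = J (min m n) x"
proof (cases "m \<le> n")
  case True
  then show ?thesis using J_cong[of m "J n x" x] J_below[of _ n x] by (simp add: min_def)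
next
  case False
  then have "J m (J n x) = J n x"
    by (intro J_unique) (auto simp: J_outside J_above)
  then show ?thesis using False by (simp add: min_def)
qed

lemma J_lin_comb: "J n (lin_comb a b x y) = lin_comb a b (J n x) (J n y)"
proof (rule J_unique)
  fix \<gamma> assume "\<gamma> \<in> \<Gamma>" "\<gamma> \<noteq> Root" "n \<le> node_rank \<gamma>"
  note above = J_above[OF this(1,3,2)]
  have "cst \<gamma> (lin_comb a b (J n x) (J n y)) = a * cst \<gamma> (J n x) + b * cst \<gamma> (J n y)"
    using cstar_lin unfolding lin_fun_def by blast
  also have "\<dots> = a * J n x \<gamma> + b * J n y \<gamma>"
    by (simp only: above[symmetric])
  finally show "lin_comb a b (J n x) (J n y) \<gamma> = cst \<gamma> (lin_comb a b (J n x) (J n y))"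
    by (simp add: lin_comb_def)
qed (auto simp: lin_comb_def J_outside J_below J_def[of 0])

lemma J_add: "J n (\<lambda>\<gamma>. x \<gamma> + y \<gamma>) = (\<lambda>\<gamma>. J n x \<gamma> + J n y \<gamma>)"
  using J_lin_comb[of n 1 1 x y] by (simp add: lin_comb_def)

lemma J_diff: "J n (\<lambda>\<gamma>. x \<gamma> - y \<gamma>) = (\<lambda>\<gamma>. J n x \<gamma> - J n y \<gamma>)"
  using J_lin_comb[of n 1 "-1" x y] by (simp add: lin_comb_def)

lemma J_scale: "J n (\<lambda>\<gamma>. a * x \<gamma>) = (\<lambda>\<gamma>. a * J n x \<gamma>)"
  using J_lin_comb[of n a 0 x x] by (simp add: lin_comb_def)

lemma J_zero: "J n (\<lambda>_. 0) = (\<lambda>_. 0)"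
  using J_scale[of n 0 "\<lambda>_. 0"] by simp

lemma J_0: "J 0 x = (\<lambda>_. 0)"
  by (simp add: J_def)

lemma J_sum: "J n (\<lambda>\<gamma>. \<Sum>k\<in>F. x k \<gamma>) = (\<lambda>\<gamma>. \<Sum>k\<in>F. J n (x k) \<gamma>)"
  by (induction F rule: infinite_finite_induct) (simp_all add: J_zero J_add)

text \<open>The bound of \<open>extend_bound\<close> on the extension operators, uniform in the
  levels.\<close>

definition C :: real where "C = real N / (real N - 2 * \<theta>)"

lemma C_ge1: "1 \<le> C"
  using \<theta>_pos \<theta>_less by (simp add: C_def field_simps)

lemma J_bound:
  assumes "\<And>\<gamma>. \<gamma> \<in> \<Gamma> \<Longrightarrow> node_rank \<gamma> < n \<Longrightarrow> \<bar>x \<gamma>\<bar> \<le> B" "0 \<le> B"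
  shows "\<bar>J n x \<gamma>\<bar> \<le> C * B"
proof -
  have CB: "0 \<le> C * B" "B \<le> C * B"
    using C_ge1 assms(2) by (auto simp: mult_le_cancel_right1)
  show ?thesis
  proof (cases "\<gamma> \<in> \<Gamma> \<and> n \<noteq> 0")
    case True
    then obtain p where n: "n = Suc p" by (cases n) auto
    have "\<bar>restr N \<omega> \<M> p x \<beta>\<bar> \<le> B" for \<beta>
      using assms n by (auto simp: restr_def Gamma_iff)
    \<comment> \<open>The maximum gives a level that is at least \<open>p\<close> and contains
      \<gamma>.\<close>
    then have "\<bar>extend N \<omega> \<M> cst p (max p (node_rank \<gamma>)) (restr N \<omega> \<M> p x) \<gamma>\<bar> \<le> C * B"
      unfolding C_def using N_pos \<theta>_pos \<theta>_less assms(2)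
      by (intro extend_bound) (auto simp: restr_def)
    then show ?thesis
      using J_extend[of p "max p (node_rank \<gamma>)" \<gamma> x] True n by (simp add: Gamma_iff)
  next
    case False
    then show ?thesis using CB by (auto simp: J_outside J_0)
  qed
qed

text \<open>Signs, intervals, nodes and weights at level \<open>q + 1\<close> range over the finite
  set \<open>S\<close>, and successive non-empty intervals make the entries of a list distinct;
  there are only finitely many distinct lists over \<open>S\<close>.\<close>

lemma finite_Delta: "finite (\<Delta> p)"
proof (induction p rule: less_induct)
  case (less p)
  show ?case
  proof (cases p)
    case (Suc q)
    have fin: "finite (\<Gamma>upto r)" if "r \<le> q" for r
      using less Suc that by (auto simp: Gamma_upto_def simp del: Delta.simps)
    define S where "S = {-1, 1::int} \<times> Pow {0..q} \<times> \<Gamma>upto q \<times> {0..q + 1}"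
    have "finite S" using fin by (simp add: S_def)
    have "ts \<in> {ts. set ts \<subseteq> S \<and> distinct ts}"
      if ts: "adm q I (\<Gamma>upto q) ts" "I \<subseteq> {0..q}" for ts I
    proof -
      have "h \<le> q + 1" if "(\<epsilon>, E, \<eta>, h) \<in> set ts" for \<epsilon> E \<eta> h
      proof -
        have "h \<le> (\<Sum>(\<epsilon>, E, \<eta>, h)\<leftarrow>ts. h)"
          using that by (intro member_le_sum_list) force+
        then show ?thesis using ts by (auto simp: admissible_def)
      qed
      then have "set ts \<subseteq> S"
        using adm_elem[OF ts(1)] ts(2) unfolding S_def by fastforce
      moreover have "distinct ts"
      proof -
        have "interval E \<Longrightarrow> E \<noteq> {}" for E by (auto simp: interval_def)
        moreover have "\<forall>(\<epsilon>, E, \<eta>, h)\<in>set ts. interval E"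
          using adm_elem[OF ts(1)] by blast
        moreover have "sorted_wrt (\<lambda>(_, E, _, _) (_, E', _, _). \<forall>a\<in>E. \<forall>b\<in>E'. a < b) ts"
          using ts(1) by (auto simp: admissible_def)
        ultimately show ?thesis
          by (induction ts) (auto, fastforce)
      qed
      ultimately show ?thesis by simp
    qed
    then have *: "\<Delta> p \<subseteq> NodeA (Suc q) ` {ts. set ts \<subseteq> S \<and> distinct ts} \<union>
       (\<lambda>(\<xi>, ts). NodeB (Suc q) \<xi> ts) ` (\<Gamma>upto (q - 1) \<times> {ts. set ts \<subseteq> S \<and> distinct ts})"
      by (auto simp: Suc Gamma_upto_def image_iff)
    have "finite {ts. set ts \<subseteq> S \<and> distinct ts}"
      using \<open>finite S\<close> by (rule finite_subset_distinct)
    then show ?thesis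
      using fin by (intro finite_subset[OF *]) auto
  qed simp
qed

lemma finite_below: "finite {\<gamma> \<in> \<Gamma>. node_rank \<gamma> < n}"
proof (rule finite_subset)
  show "{\<gamma> \<in> \<Gamma>. node_rank \<gamma> < n} \<subseteq> (\<Union>i<n. \<Delta> i)" using in_Delta by blast
qed (auto intro: finite_Delta simp del: Delta.simps)

section \<open>The space \<open>X\<close> and its approximation by the projections
  \<open>J\<close>\<close>

abbreviation "dvec \<equiv> d_vec N \<theta> \<omega> \<M>"
abbreviation "X \<equiv> BD_space N \<theta> \<omega> \<M>"

lemma apply_dvec: "\<gamma> \<in> \<Gamma> \<Longrightarrow> apply_bcontfun (dvec \<gamma>) = J (Suc (node_rank \<gamma>)) (indicator {\<gamma>})"
proof -
  assume "\<gamma> \<in> \<Gamma>"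
  moreover from this have "restr N \<omega> \<M> (node_rank \<gamma>) (indicator {\<gamma>}) = indicator {\<gamma>}"
    by (auto simp: restr_def Gamma_iff indicator_def)
  ultimately show ?thesis
    using \<theta>_pos \<theta>_less by (simp add: J_def apply_d_vec)
qed

lemma span_dvec_fixed:
  assumes "z \<in> span (dvec ` \<Gamma>)"
  shows "\<exists>n. J n z = z"
  using assms
proof (induction rule: span_induct_alt)
  case base
  show ?case by (simp add: zero_bcontfun.rep_eq J_zero)
next
  case (step c y z)
  then obtain n \<gamma> where *: "\<gamma> \<in> \<Gamma>" "y = dvec \<gamma>" "J n z = z" by auto
  define m where "m = max n (Suc (node_rank \<gamma>))"
  have "J m z = z" using J_J[of m n z] * by (simp add: m_def)
  moreover have "J m y = y"
    using J_J[of m "Suc (node_rank \<gamma>)" "indicator {\<gamma>}"] * by (simp add: m_def apply_dvec)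
  ultimately have "J m (c *\<^sub>R y + z) = c *\<^sub>R y + z"
    by (simp add: plus_bcontfun.rep_eq scaleR_bcontfun.rep_eq J_add J_scale)
  then show ?case by blast
qed

text \<open>Passing from \<open>J n x\<close> to \<open>J (Suc n) x\<close> changes only the
  prescribed values at the finitely many nodes of rank \<open>n\<close>, and multiples of the
  vectors \<open>dvec\<close> at these nodes make the correction.\<close>

lemma J_in_span: "\<exists>z\<in>span (dvec ` \<Gamma>). apply_bcontfun z = J n x"
proof (induction n)
  case 0
  show ?case by (intro bexI[of _ 0]) (auto simp: J_0 zero_bcontfun.rep_eq span_zero)
next
  case (Suc n)
  then obtain z where z: "z \<in> span (dvec ` \<Gamma>)" "apply_bcontfun z = J n x" by blast
  define S where "S = {\<gamma>\<in>\<Gamma>. node_rank \<gamma> = n}"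
  \<comment> \<open>The defect at \<gamma> between \<open>x\<close> and the extension of its values
    below rank \<open>n\<close>.\<close>
  define c where "c \<gamma> = x \<gamma> - J n x \<gamma>" for \<gamma>
  have fin: "finite S"
    by (rule finite_subset[OF _ finite_below[of "Suc n"]]) (auto simp: S_def)
  define z' where "z' = z + (\<Sum>\<gamma>\<in>S. c \<gamma> *\<^sub>R dvec \<gamma>)"
  have "z' \<in> span (dvec ` \<Gamma>)"
    unfolding z'_def using z(1)
    by (intro span_add span_sum span_scale) (auto simp: S_def intro: span_base)
  moreover have "apply_bcontfun z' = J (Suc n) x"
  proof -
    \<comment> \<open>This function agrees with \<open>x\<close> at all nodes of rank at most
      \<open>n\<close>, while \<open>J (Suc n)\<close> maps it to \<open>z'\<close>.\<close>
    define y where "y \<gamma> = J n x \<gamma> + (\<Sum>\<beta>\<in>S. c \<beta> * indicator {\<beta>} \<gamma>)" for \<gamma>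
    have "J (Suc n) y = (\<lambda>\<gamma>. J n x \<gamma> + (\<Sum>\<beta>\<in>S. c \<beta> * J (Suc n) (indicator {\<beta>}) \<gamma>))"
      unfolding y_def by (simp add: J_add J_sum J_scale J_J)
    also have "\<dots> = apply_bcontfun z'"
      unfolding z'_def by (auto simp: apply_sum z(2) S_def apply_dvec scaleR_bcontfun.rep_eq plus_bcontfun.rep_eq fun_eq_iff)
    finally have "apply_bcontfun z' = J (Suc n) y" by simp
    also have "\<dots> = J (Suc n) x"
    proof (rule J_cong)
      fix \<gamma> assume \<gamma>: "\<gamma> \<in> \<Gamma>" "node_rank \<gamma> < Suc n"
      have "(\<Sum>\<beta>\<in>S. c \<beta> * indicator {\<beta>} \<gamma>) = (\<Sum>\<beta>\<in>S. if \<gamma> = \<beta> then c \<beta> else 0)"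
        by (intro sum.cong) (auto simp: indicator_def)
      also have "\<dots> = (if \<gamma> \<in> S then c \<gamma> else 0)"
        using fin by simp
      finally show "y \<gamma> = x \<gamma>"
        using \<gamma> J_below[of \<gamma> n x] by (auto simp: y_def S_def c_def)
    qed
    finally show ?thesis .
  qed
  ultimately show ?case by blast
qed

lemma span_subset_X: "span (dvec ` \<Gamma>) \<subseteq> X"
  unfolding BD_space_def by (rule closure_subset)

lemma X_approx:
  assumes "x \<in> X" "0 < \<delta>"
  obtains z n where "z \<in> X" "J n (apply_bcontfun z) = apply_bcontfun z" "norm (x - z) < \<delta>"
proof -
  obtain z where z: "z \<in> span (dvec ` \<Gamma>)" "dist z x < \<delta>"
    using assms unfolding BD_space_def closure_approachable by blast
  obtain n where "J n z = z" using span_dvec_fixed[OF z(1)] by blast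
  then show ?thesis
    using that[of z n] z span_subset_X by (auto simp: dist_norm norm_minus_commute)
qed

lemma X_outside:
  assumes "x \<in> X" "\<gamma> \<notin> \<Gamma>"
  shows "apply_bcontfun x \<gamma> = 0"
proof (rule ccontr)
  assume "apply_bcontfun x \<gamma> \<noteq> 0"
  then have "0 < \<bar>apply_bcontfun x \<gamma>\<bar>" by simp
  from X_approx[OF assms(1) this]
  obtain z n where "J n (apply_bcontfun z) = apply_bcontfun z" "norm (x - z) < \<bar>apply_bcontfun x \<gamma>\<bar>"
    by blast
  moreover from this have "apply_bcontfun z \<gamma> = 0" using J_outside[OF assms(2)] by metis
  ultimately show False using norm_bounded[of "x - z" \<gamma>] by (simp add: minus_bcontfun.rep_eq)
qed

text \<open>The projections are uniformly bounded, and on a dense set they eventually act as the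
  identity.\<close>

lemma X_tail:
  assumes "x \<in> X" "0 < \<delta>"
  obtains p where "\<And>n \<gamma>. p \<le> n \<Longrightarrow> \<bar>apply_bcontfun x \<gamma> - J n x \<gamma>\<bar> \<le> \<delta>"
proof -
  \<comment> \<open>The approximation error enters once directly and once through
    \<open>J n\<close>, for a total of \<open>d + C * d\<close>.\<close>
  define d where "d = \<delta> / (1 + C)"
  have "0 < d" "d * (1 + C) = \<delta>" using assms(2) C_ge1 by (auto simp: d_def)
  then have d: "0 < d" "d + C * d = \<delta>" by (auto simp: algebra_simps)
  obtain z p where z: "J p (apply_bcontfun z) = apply_bcontfun z" "norm (x - z) < d" using X_approx[OF assms(1) d(1)] by blast
  have xz: "\<bar>apply_bcontfun z \<gamma> - apply_bcontfun x \<gamma>\<bar> \<le> d" for \<gamma>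
    using norm_bounded[of "x - z" \<gamma>] z(2) by (simp add: minus_bcontfun.rep_eq)
  have "\<bar>apply_bcontfun x \<gamma> - J n x \<gamma>\<bar> \<le> \<delta>" if "p \<le> n" for n \<gamma>
  proof -
    have "J n z = z" using J_J[of n p z] z(1) that by simp
    moreover have "\<bar>J n (\<lambda>\<gamma>. apply_bcontfun z \<gamma> - apply_bcontfun x \<gamma>) \<gamma>\<bar> \<le> C * d"
      using xz d by (intro J_bound) auto
    ultimately show ?thesis using xz[of \<gamma>] d(2) by (simp add: J_diff)
  qed
  then show ?thesis using that by blast
qed

lemma subspace_X: "subspace X"
  unfolding BD_space_def by (simp add: subspace_closure)

end

section \<open>The case of an infinite set in the family\<close>

text \<open>Makes the closed subspace \<open>X\<close> complete, so that its image under an operator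
  bounded below is closed.\<close>

lemma complete_bcontfun_UNIV: "complete (UNIV :: ('a::topological_space \<Rightarrow>\<^sub>C 'b::complete_space) set)"
  unfolding complete_def
proof (intro allI impI)
  fix f :: "nat \<Rightarrow> ('a \<Rightarrow>\<^sub>C 'b)" assume "(\<forall>n. f n \<in> UNIV) \<and> Cauchy f"
  then obtain g where "uniform_limit UNIV f g sequentially"
    using uniformly_convergent_eq_cauchy[of "\<lambda>_. True" f]
    unfolding Cauchy_def uniform_limit_sequentially_iff
    by (metis dist_fun_lt_imp_dist_val_lt)
  from uniform_limit_bcontfunE[OF this sequentially_bot]
  obtain l where "f \<longlonglongrightarrow> l" by metis
  then show "\<exists>l\<in>UNIV. f \<longlonglongrightarrow> l" by blast
qed

text \<open>The lower estimate makes the inverse on the image Lipschitz with constant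
  \<open>K\<close>.\<close>

lemma isomorphic_subspaces_bounded_below:
  fixes T :: "'a::real_normed_vector \<Rightarrow> 'b::real_normed_vector"
  assumes T: "bounded_linear T" and S: "subspace S" and K: "0 < K" "\<And>x. x \<in> S \<Longrightarrow> norm x \<le> K * norm (T x)"
  shows "isomorphic_subspaces S (T ` S)"
proof -
  interpret T: bounded_linear T by fact
  have diff: "norm (x - y) \<le> K * norm (T x - T y)" if "x \<in> S" "y \<in> S" for x y
    using K(2)[OF subspace_diff[OF S that]] by (simp add: T.diff)
  have inj: "inj_on T S" using diff by (fastforce intro: inj_onI)
  have "homeomorphism S (T ` S) T (inv_into S T)"
  proof (rule homeomorphismI)
    show "continuous_on (T ` S) (inv_into S T)"
      unfolding continuous_on_iff
    proof (intro ballI allI impI)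
      fix y and \<epsilon> :: real assume "y \<in> T ` S" "0 < \<epsilon>"
      then show "\<exists>d>0. \<forall>y'\<in>T ` S. dist y' y < d \<longrightarrow> dist (inv_into S T y') (inv_into S T y) < \<epsilon>"
      proof (intro exI[of _ "\<epsilon> / K"] conjI ballI impI)
        fix y' assume "y' \<in> T ` S" "dist y' y < \<epsilon> / K"
        then have "K * norm (y' - y) < \<epsilon>" using K(1) by (simp add: dist_norm field_simps)
        moreover have "norm (inv_into S T y' - inv_into S T y) \<le> K * norm (y' - y)"
          using diff[of "inv_into S T y'" "inv_into S T y"] \<open>y \<in> T ` S\<close> \<open>y' \<in> T ` S\<close>
          by (simp add: inv_into_into f_inv_into_f)
        ultimately show "dist (inv_into S T y') (inv_into S T y) < \<epsilon>" by (simp add: dist_norm)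
      qed (use \<open>0 < \<epsilon>\<close> K(1) in auto)
    qed
  qed (auto simp: inj f_inv_into_f inv_into_into intro: linear_continuous_on T)
  then show ?thesis
    unfolding isomorphic_subspaces_def using T.add T.scaleR by blast
qed

section \<open>Bounds for vectors controlled on the rank segments not cut by a set of the
  family\<close>

context bd_param
begin

text \<open>\<open>J b - J a\<close> projects onto the ranks from \<open>a\<close> up to
  \<open>b - 1\<close>. The open interval allows such a segment to begin at a point of
  \<open>A\<close>, so it may be a whole block between consecutive points of
  \<open>A\<close>.\<close>

definition flat :: "nat set \<Rightarrow> real \<Rightarrow> (node \<Rightarrow> real) \<Rightarrow> bool" where
  "flat A D x \<longleftrightarrow> (\<forall>a b \<gamma>. a \<le> b \<longrightarrow> {a<..<b} \<inter> A = {} \<longrightarrow> \<bar>J b x \<gamma> - J a x \<gamma>\<bar> \<le> D)"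

text \<open>Projecting onto two segments in succession projects onto their intersection, or gives
  zero when they are disjoint. This stability lets the induction in \<open>flat_bound\<close> pass
  from \<open>x\<close> to \<open>PE E x\<close>.\<close>

lemma flat_segment:
  assumes "flat A D x" "c \<le> d" "0 \<le> D"
  shows "flat A D (\<lambda>\<gamma>. J d x \<gamma> - J c x \<gamma>)"
  unfolding flat_def
proof (intro allI impI)
  fix a b :: nat and \<gamma> assume ab: "a \<le> b" "{a<..<b} \<inter> A = {}"
  let ?e = "J b (\<lambda>\<gamma>. J d x \<gamma> - J c x \<gamma>) \<gamma> - J a (\<lambda>\<gamma>. J d x \<gamma> - J c x \<gamma>) \<gamma>"
  have e: "?e = J (min b d) x \<gamma> - J (min b c) x \<gamma> - (J (min a d) x \<gamma> - J (min a c) x \<gamma>)"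
    by (simp add: J_diff J_J)
  show "\<bar>?e\<bar> \<le> D"
  proof (cases "max a c \<le> min b d")
    case True
    then have "?e = J (min b d) x \<gamma> - J (max a c) x \<gamma>"
      unfolding e using ab(1) assms(2) by (cases "c \<le> a") (auto simp: min_def max_def)
    moreover have "{max a c<..<min b d} \<inter> A = {}" using ab(2) by auto
    ultimately show ?thesis using assms(1) True unfolding flat_def by presburger
  next
    case False
    then have "?e = 0"
      unfolding e using ab(1) assms(2) by (cases "c \<le> a") (auto simp: min_def max_def)
    then show ?thesis using assms(3) by simp
  qed
qed

text \<open>\<open>D\<close> is charged to every entry, and \<open>K\<close> in addition to those
  whose interval meets \<open>A\<close>.\<close>

lemma sum_list_quad_bound:
  assumes "\<And>\<epsilon> E \<eta> h. (\<epsilon>, E, \<eta>, h) \<in> set ts \<Longrightarrow> \<epsilon> \<in> {-1, 1::int} \<and> \<bar>f E \<eta>\<bar> \<le> (if E \<inter> A \<noteq> {} then K else D)"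
    "0 \<le> D" "0 \<le> K"
  shows "\<bar>\<Sum>(\<epsilon>, E, \<eta>, h)\<leftarrow>ts. real h * of_int \<epsilon> * f E \<eta>\<bar> \<le>
    real (\<Sum>(\<epsilon>, E, \<eta>, h)\<leftarrow>ts. h) * D + real (\<Sum>(\<epsilon>, E, \<eta>, h)\<leftarrow>ts. if E \<inter> A \<noteq> {} then h else 0) * K"
  using assms(1)
proof (induction ts)
  case (Cons t ts)
  obtain \<epsilon> E \<eta> h where t: "t = (\<epsilon>, E, \<eta>, h)" by (cases t) auto
  have "\<epsilon> \<in> {-1, 1}" and f: "\<bar>f E \<eta>\<bar> \<le> (if E \<inter> A \<noteq> {} then K else D)"
    using Cons.prems[of \<epsilon> E \<eta> h] t by auto
  then have "\<bar>real h * of_int \<epsilon> * f E \<eta>\<bar> = real h * \<bar>f E \<eta>\<bar>"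
    by (auto simp: abs_mult)
  also have "\<dots> \<le> real h * D + real (if E \<inter> A \<noteq> {} then h else 0) * K"
    using f assms(2,3) mult_left_mono[OF f, of "real h"] by (auto split: if_splits intro: order_trans)
  finally have "\<bar>real h * of_int \<epsilon> * f E \<eta>\<bar> \<le> real h * D + real (if E \<inter> A \<noteq> {} then h else 0) * K" .
  moreover have "\<bar>\<Sum>(\<epsilon>, E, \<eta>, h)\<leftarrow>ts. real h * of_int \<epsilon> * f E \<eta>\<bar> \<le>
    real (\<Sum>(\<epsilon>, E, \<eta>, h)\<leftarrow>ts. h) * D + real (\<Sum>(\<epsilon>, E, \<eta>, h)\<leftarrow>ts. if E \<inter> A \<noteq> {} then h else 0) * K"
    by (intro Cons.IH Cons.prems) auto
  ultimately show ?case
    unfolding t by (simp add: distrib_right)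
qed simp

text \<open>The two admissibility requirements enter here: the total weight is at most
  \<open>q + 1\<close>, and the weight of the intervals meeting \<open>A\<close> is below
  \<open>\<omega> * (q + 1)\<close>.\<close>

lemma W_bound:
  assumes "adm q I (\<Gamma>upto q) ts" "A \<in> \<M>" "0 \<le> D" "0 \<le> K"
    and "\<And>\<epsilon> E \<eta> h. (\<epsilon>, E, \<eta>, h) \<in> set ts \<Longrightarrow> \<bar>PE E x \<eta>\<bar> \<le> (if E \<inter> A \<noteq> {} then K else D)"
  shows "\<bar>W q ts x\<bar> \<le> \<theta> / real N * (D + \<omega> * K)"
proof -
  have 1: "(\<Sum>(\<epsilon>, E, \<eta>, h)\<leftarrow>ts. h) \<le> q + 1"
    and 2: "real (\<Sum>(\<epsilon>, E, \<eta>, h)\<leftarrow>ts. if E \<inter> A \<noteq> {} then h else 0) < \<omega> * real (q + 1)"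
    using assms(1,2) by (auto simp: admissible_def)
  have "\<bar>\<Sum>(\<epsilon>, E, \<eta>, h)\<leftarrow>ts. real h * of_int \<epsilon> * PE E x \<eta>\<bar> \<le>
      real (\<Sum>(\<epsilon>, E, \<eta>, h)\<leftarrow>ts. h) * D + real (\<Sum>(\<epsilon>, E, \<eta>, h)\<leftarrow>ts. if E \<inter> A \<noteq> {} then h else 0) * K"
    using adm_elem[OF assms(1)] assms(3-5) by (intro sum_list_quad_bound) auto
  also have "\<dots> \<le> real (q + 1) * D + (\<omega> * real (q + 1)) * K"
    using 1 2 assms(3,4) by (intro add_mono mult_right_mono) linarith+
  also have "\<dots> = real (q + 1) * (D + \<omega> * K)" by (simp add: algebra_simps)
  finally have "\<theta> / real N * (1 / real (q + 1)) * \<bar>\<Sum>(\<epsilon>, E, \<eta>, h)\<leftarrow>ts. real h * of_int \<epsilon> * PE E x \<eta>\<bar>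
      \<le> \<theta> / real N * (1 / real (q + 1)) * (real (q + 1) * (D + \<omega> * K))"
    using \<theta>_pos by (intro mult_left_mono) auto
  then show ?thesis
    using \<theta>_pos by (simp add: W_def abs_mult)
qed

text \<open>Along the ages of a node, the intervals that miss \<open>A\<close> contribute at most \<open>\<theta> D / N\<close> each time and
  the others at most \<open>\<theta> \<omega> K / N\<close>, where \<open>K\<close> is the bound to be proved; as \<open>\<theta> \<omega> < 1\<close>, this is
  consistent.\<close>

lemma flat_bound:
  assumes A: "A \<in> \<M>" and \<omega>: "0 < \<omega>" "\<theta> * \<omega> < 1" and D: "0 \<le> D"
    and x: "flat A D x" "\<gamma> \<in> \<Gamma>"
  shows "\<bar>x \<gamma>\<bar> \<le> (real N + \<theta>) / (1 - \<theta> * \<omega>) * D"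
proof -
  define K where "K = (real N + \<theta>) / (1 - \<theta> * \<omega>) * D"
  \<comment> \<open>The contribution of one age: a single coordinate plus one weighted average.
    \<open>K\<close> is the solution of \<open>N * B = K\<close>, so at most \<open>N\<close> ages
    reproduce the bound \<open>K\<close>.\<close>
  define B where "B = D + \<theta> / real N * (D + \<omega> * K)"
  have K0: "0 \<le> K" using \<omega>(2) \<theta>_pos D by (simp add: K_def)
  have BN: "real N * B = K"
  proof -
    have "real N * B = (real N + \<theta>) * D + \<theta> * \<omega> * K"
      using N_pos by (simp add: B_def field_simps)
    also have "(real N + \<theta>) * D = (1 - \<theta> * \<omega>) * K"
      using \<omega>(2) by (simp add: K_def)
    finally show ?thesis by (simp add: algebra_simps)
  qed
  have B: "0 \<le> B" "D \<le> B"
    using K0 D \<omega> \<theta>_pos by (auto simp: B_def)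
  have "1 \<le> N" using N_pos by simp
  have BK: "max 1 (real (age \<gamma>)) * B \<le> K" if "\<gamma> \<in> \<Gamma>" for \<gamma>
    unfolding BN[symmetric] using age_le[OF that] \<open>1 \<le> N\<close> B by (intro mult_right_mono) auto
  \<comment> \<open>The maximum with \<open>1\<close> covers \<open>Root\<close>, whose age is the
    dummy \<open>0\<close>. The vector varies in the induction because the segments
    \<open>PE E x\<close> take its place.\<close>
  have main: "\<bar>x \<gamma>\<bar> \<le> max 1 (real (age \<gamma>)) * B" if "flat A D x" "\<gamma> \<in> \<Gamma>" for x \<gamma>
    using that
  proof (induction "node_rank \<gamma>" arbitrary: x \<gamma> rule: less_induct)
    case less
    \<comment> \<open>A segment consisting of one rank has an empty open interval, so
      \<open>flat\<close> applies to it whatever \<open>A\<close> is.\<close>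
    have "\<bar>J (Suc (node_rank \<gamma>)) x \<gamma> - J (node_rank \<gamma>) x \<gamma>\<bar> \<le> D"
      using less.prems(1)[unfolded flat_def, rule_format, of "node_rank \<gamma>" "Suc (node_rank \<gamma>)" \<gamma>]
      by (simp add: atLeastSucLessThan_greaterThanLessThan[symmetric])
    then have d: "\<bar>x \<gamma> - J (node_rank \<gamma>) x \<gamma>\<bar> \<le> D"
      using J_below[OF less.prems(2)] by simp
    have cst: "J (node_rank \<gamma>) x \<gamma> = cst \<gamma> x" if "\<gamma> \<noteq> Root"
    proof -
      have "cst \<gamma> (J (node_rank \<gamma>) x) = cst \<gamma> x"
        using less.prems(2) that by (intro cst_cong) (auto simp: J_below)
      then show ?thesis using J_above[OF less.prems(2) order_refl that] by simp
    qed
    have W: "\<bar>W q ts x\<bar> \<le> \<theta> / real N * (D + \<omega> * K)"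
      if ts: "adm q I (\<Gamma>upto q) ts" "q < node_rank \<gamma>" for q I ts
    proof (rule W_bound[OF ts(1) A D K0])
      fix \<epsilon> E \<eta> h assume "(\<epsilon>, E, \<eta>, h) \<in> set ts"
      note t = adm_elem[OF ts(1) this]
      have E: "Min E \<le> Suc (Max E)" "E = {Min E..Max E}"
        using t(2) by (auto elim!: interval_MinMax)
      have \<eta>: "\<eta> \<in> \<Gamma>" "node_rank \<eta> < node_rank \<gamma>" using t(4) ts(2) by (auto simp: Gamma_iff)
      have "\<bar>PE E x \<eta>\<bar> \<le> max 1 (real (age \<eta>)) * B"
        unfolding PE_def using \<eta> by (intro less.hyps flat_segment less.prems(1) E(1) D)
      then have 1: "\<bar>PE E x \<eta>\<bar> \<le> K" using BK[OF \<eta>(1)] by simp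
      \<comment> \<open>An interval that misses \<open>A\<close> is itself a segment covered by
        \<open>flat\<close>; the induction hypothesis is used only for the larger bound
        \<open>K\<close>.\<close>
      have 2: "\<bar>PE E x \<eta>\<bar> \<le> D" if "E \<inter> A = {}"
      proof -
        have "{Min E<..<Suc (Max E)} \<subseteq> E" by (subst E(2)) auto
        then have "{Min E<..<Suc (Max E)} \<inter> A = {}" using that by blast
        then show ?thesis using less.prems(1) E(1) unfolding flat_def PE_def by blast
      qed
      show "\<bar>PE E x \<eta>\<bar> \<le> (if E \<inter> A \<noteq> {} then K else D)" using 1 2 by auto
    qed
    show ?case
      using less.prems(2)
    proof (cases \<gamma> rule: node_cases)
      case Root
      then show ?thesis using d B by (simp add: J_0)
    next
      case (A q ts)
      have "\<bar>cst \<gamma> x\<bar> \<le> \<theta> / real N * (D + \<omega> * K)" using W[OF A(2)] A(1,3) by simp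
      moreover have "J (node_rank \<gamma>) x \<gamma> = cst \<gamma> x" "max 1 (real (age \<gamma>)) = 1" using cst A(1) by simp_all
      ultimately show ?thesis using d unfolding B_def by simp
    next
      case (B q \<xi> ts)
      have "\<bar>cst \<gamma> x - x \<xi>\<bar> \<le> \<theta> / real N * (D + \<omega> * K)" using W[OF B(6)] B(1,7) by simp
      moreover have "\<bar>x \<xi>\<bar> \<le> max 1 (real (age \<xi>)) * B"
        using B(1,2,4) less.prems(1) by (intro less.hyps) auto
      moreover have "age \<xi> \<noteq> 0" using B(3) by (cases \<xi>) auto
      then have ages: "max 1 (real (age \<xi>)) = real (age \<xi>)" "max 1 (real (age \<gamma>)) = real (age \<xi>) + 1"
        using B(1) by auto
      moreover have "J (node_rank \<gamma>) x \<gamma> = cst \<gamma> x" using cst B(1) by simp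
      moreover have "(real (age \<xi>) + 1) * B = real (age \<xi>) * B + D + \<theta> / real N * (D + \<omega> * K)"
        by (simp only: distrib_right B_def mult_1_left add.assoc)
      ultimately show ?thesis using d unfolding ages by linarith
    qed
  qed
  show ?thesis using main[OF x] BK[OF x(2)] by (simp add: K_def)
qed

end

section \<open>Coordinates along the blocks cut out by \<open>A\<close>, and the isomorphism onto
  \<open>c0\<close>\<close>

locale bd_infinite = bd_param +
  fixes A :: "nat set"
  assumes A_in: "A \<in> \<M>" and A_inf: "infinite A" and \<omega>_pos: "0 < \<omega>" and \<theta>\<omega>: "\<theta> * \<omega> < 1"
begin

text \<open>The first rank of the block containing \<open>r\<close>. Blocks begin at the elements of
  \<open>A\<close>; the ranks before the first element belong to a block beginning at
  \<open>0\<close>.\<close>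

definition start :: "nat \<Rightarrow> nat" where
  "start r = (if \<exists>a\<in>A. a \<le> r then Max {a \<in> A. a \<le> r} else 0)"

lemma start_le: "start r \<le> r"
proof (cases "\<exists>a\<in>A. a \<le> r")
  case True
  then have "Max {a \<in> A. a \<le> r} \<in> {a \<in> A. a \<le> r}" by (intro Max_in) auto
  then show ?thesis using True by (simp add: start_def)
qed (simp add: start_def)

lemma start_in: "start r \<in> insert 0 A"
proof (cases "\<exists>a\<in>A. a \<le> r")
  case True
  then have "Max {a \<in> A. a \<le> r} \<in> {a \<in> A. a \<le> r}" by (intro Max_in) auto
  then show ?thesis using True by (simp add: start_def)
qed (simp add: start_def)

lemma start_ge: "a \<in> A \<Longrightarrow> a \<le> r \<Longrightarrow> a \<le> start r"
  by (auto simp: start_def intro!: Max_ge)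

text \<open>The value at \<open>\<gamma>\<close> of the projection of \<open>x\<close> onto the block of ranks, cut out by \<open>A\<close>, that contains the
  rank of \<open>\<gamma>\<close>.\<close>

definition coord :: "(node \<Rightarrow> real) \<Rightarrow> node \<Rightarrow> real" where
  "coord x \<gamma> = x \<gamma> - J (start (node_rank \<gamma>)) x \<gamma>"

text \<open>On a single block beginning at \<open>p\<close>, \<open>coord x\<close> is
  \<open>x - J p x\<close>. Hence initial segments of the block have norm at most
  \<open>C * t\<close>, and an arbitrary segment is a difference of two of these.\<close>

lemma flat_coord:
  assumes "\<And>\<gamma>. \<gamma> \<in> \<Gamma> \<Longrightarrow> \<bar>coord x \<gamma>\<bar> \<le> t" "0 \<le> t"
  shows "flat A (2 * (C * t)) x"
  unfolding flat_def
proof (intro allI impI)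
  fix a b :: nat and \<gamma> assume ab: "a \<le> b" "{a<..<b} \<inter> A = {}"
  define p where "p = start a"
  \<comment> \<open>No element of \<open>A\<close> lies strictly between \<open>a\<close> and
    \<open>b\<close>, so every rank from \<open>p\<close> up to \<open>b - 1\<close> belongs to the
    block beginning at \<open>p\<close>.\<close>
  have p: "p \<le> a" "\<And>r. p \<le> r \<Longrightarrow> r < b \<Longrightarrow> start r = p"
  proof -
    show "p \<le> a" unfolding p_def by (rule start_le)
    fix r assume r: "p \<le> r" "r < b"
    show "start r = p"
    proof (rule antisym)
      show "p \<le> start r" using start_in[of a] start_ge[of p r] r by (auto simp: p_def)
      have "start r \<le> a \<or> start r \<notin> A" using ab(2) start_le[of r] r by (auto simp: disjoint_iff)
      then show "start r \<le> p" using start_in[of r] start_ge[of "start r" a] by (auto simp: p_def)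
    qed
  qed
  have seg: "\<bar>J s x \<gamma> - J p x \<gamma>\<bar> \<le> C * t" if s: "p \<le> s" "s \<le> b" for s
  proof -
    have "(\<lambda>\<gamma>. J s x \<gamma> - J p x \<gamma>) = J s (\<lambda>\<gamma>. J s x \<gamma> - J p x \<gamma>)"
      using s by (simp add: J_diff J_J)
    moreover have "\<bar>J s (\<lambda>\<gamma>. J s x \<gamma> - J p x \<gamma>) \<gamma>\<bar> \<le> C * t"
    proof (rule J_bound[OF _ assms(2)])
      fix \<beta> assume \<beta>: "\<beta> \<in> \<Gamma>" "node_rank \<beta> < s"
      show "\<bar>J s x \<beta> - J p x \<beta>\<bar> \<le> t"
      proof (cases "node_rank \<beta> < p")
        case True
        then show ?thesis using \<beta> assms(2) by (simp add: J_below)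
      next
        case False
        then have "start (node_rank \<beta>) = p" using p(2) \<beta> s by simp
        then show ?thesis using assms(1)[OF \<beta>(1)] \<beta> by (simp add: J_below coord_def)
      qed
    qed
    ultimately show ?thesis by metis
  qed
  show "\<bar>J b x \<gamma> - J a x \<gamma>\<bar> \<le> 2 * (C * t)"
    using seg[of a] seg[of b] p(1) ab(1) by linarith
qed

lemma coord_bound_below:
  assumes "\<And>\<gamma>. \<gamma> \<in> \<Gamma> \<Longrightarrow> \<bar>coord x \<gamma>\<bar> \<le> t" "0 \<le> t" "\<gamma> \<in> \<Gamma>"
  shows "\<bar>x \<gamma>\<bar> \<le> (real N + \<theta>) / (1 - \<theta> * \<omega>) * (2 * C) * t"
  using flat_bound[OF A_in \<omega>_pos \<theta>\<omega> _ flat_coord[OF assms(1,2)] assms(3)] C_ge1 assms(2)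
  by (simp add: mult.assoc)

lemma coord_bound_above:
  assumes "\<And>\<gamma>. \<bar>x \<gamma>\<bar> \<le> t" "0 \<le> t"
  shows "\<bar>coord x \<gamma>\<bar> \<le> (1 + C) * t"
proof -
  have "\<bar>J (start (node_rank \<gamma>)) x \<gamma>\<bar> \<le> C * t" using assms by (intro J_bound)
  then show ?thesis using assms(1)[of \<gamma>] by (simp add: coord_def algebra_simps)
qed

text \<open>A tuple with the single weight \<open>0\<close> is admissible at every level, since
  \<open>0 < \<omega> * (q + 1)\<close>. Infinity of \<Gamma> permits its enumeration by all natural
  numbers, as needed for maps into \<open>c0\<close>.\<close>

lemma infinite_Gamma: "infinite \<Gamma>"
proof -
  have "NodeA (Suc q) [(1, {0}, Root, 0)] \<in> \<Gamma>" for q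
  proof (rule NodeA_in)
    have "Root \<in> \<Gamma>upto q" by (auto simp: Gamma_upto_def intro!: bexI[of _ 0])
    then show "adm q {0..q} (\<Gamma>upto q) [(1, {0}, Root, 0)]"
      using \<omega>_pos by (auto simp: admissible_def interval_def intro!: exI[of _ 0])
  qed
  then have "range (\<lambda>q. NodeA (Suc q) [(1, {0}, Root, 0)]) \<subseteq> \<Gamma>" by blast
  moreover have "infinite (range (\<lambda>q. NodeA (Suc q) [(1, {0}, Root, 0)]))"
    by (rule range_inj_infinite) (auto simp: inj_on_def)
  ultimately show ?thesis using finite_subset by blast
qed

lemma bij_enum: "bij_betw (from_nat_into \<Gamma>) UNIV \<Gamma>"
proof (rule bij_betw_from_nat_into[OF _ infinite_Gamma])
  have "countable (\<Delta> i)" for i by (rule countable_finite[OF finite_Delta])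
  then show "countable \<Gamma>" unfolding Gamma_all_def by (intro countable_UN) simp_all
qed

definition T :: "(node \<Rightarrow>\<^sub>C real) \<Rightarrow> (nat \<Rightarrow>\<^sub>C real)" where
  "T x = Bcontfun (\<lambda>k. coord x (from_nat_into \<Gamma> k))"

lemma apply_T: "apply_bcontfun (T x) k = coord x (from_nat_into \<Gamma> k)"
proof -
  have "\<bar>coord x \<gamma>\<bar> \<le> (1 + C) * norm x" for \<gamma>
    using norm_bounded[of x] by (intro coord_bound_above) auto
  then have "(\<lambda>k. coord x (from_nat_into \<Gamma> k)) \<in> bcontfun"
    by (auto simp: bcontfun_def bounded_iff intro!: exI[of _ "(1 + C) * norm x"])
  then show ?thesis by (simp add: T_def Bcontfun_inverse)
qed

lemma bounded_linear_T: "bounded_linear T"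
proof (rule bounded_linear_intro)
  show "T (x + y) = T x + T y" for x y
    by (rule bcontfun_eqI) (simp add: apply_T plus_bcontfun.rep_eq coord_def J_add)
  show "T (r *\<^sub>R x) = r *\<^sub>R T x" for r x
    by (rule bcontfun_eqI) (simp add: apply_T scaleR_bcontfun.rep_eq coord_def J_scale algebra_simps)
  show "norm (T x) \<le> norm x * (1 + C)" for x
  proof (rule norm_bound)
    fix k
    have "\<bar>coord x (from_nat_into \<Gamma> k)\<bar> \<le> (1 + C) * norm x"
      using norm_bounded[of x] by (intro coord_bound_above) auto
    then show "norm (apply_bcontfun (T x) k) \<le> norm x * (1 + C)"
      by (simp add: apply_T mult.commute)
  qed
qed

lemma T_bounded_below:
  assumes "x \<in> X"
  shows "norm x \<le> (real N + \<theta>) / (1 - \<theta> * \<omega>) * (2 * C) * norm (T x)"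
proof (rule norm_bound)
  fix \<gamma>
  have "\<bar>coord x \<beta>\<bar> \<le> norm (T x)" if "\<beta> \<in> \<Gamma>" for \<beta>
  proof -
    obtain k where "\<beta> = from_nat_into \<Gamma> k" using bij_enum \<open>\<beta> \<in> \<Gamma>\<close> by (auto simp: bij_betw_def)
    then show ?thesis using norm_bounded[of "T x" k] by (simp add: apply_T)
  qed
  moreover have "0 \<le> (real N + \<theta>) / (1 - \<theta> * \<omega>) * (2 * C) * norm (T x)"
    using \<theta>\<omega> \<theta>_pos C_ge1 by simp
  ultimately show "norm (apply_bcontfun x \<gamma>) \<le> (real N + \<theta>) / (1 - \<theta> * \<omega>) * (2 * C) * norm (T x)"
    using coord_bound_below[of x "norm (T x)" \<gamma>] X_outside[OF assms] by (cases "\<gamma> \<in> \<Gamma>") auto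
qed

text \<open>For nodes of rank at least \<open>a\<close>, with \<open>a\<close> in \<open>A\<close>
  beyond \<open>p\<close>, the block begins at or after \<open>a\<close>, so the coordinate is a
  tail value of \<open>x\<close> and small. Only finitely many nodes have smaller rank.\<close>

lemma T_in_c0:
  assumes "x \<in> X"
  shows "T x \<in> c0"
proof -
  have "\<forall>\<^sub>F k in sequentially. \<bar>apply_bcontfun (T x) k\<bar> < \<delta>" if "0 < \<delta>" for \<delta>
  proof -
    from that have "0 < \<delta> / 2" by simp
    from X_tail[OF assms this]
    obtain p where p: "\<And>n \<gamma>. p \<le> n \<Longrightarrow> \<bar>apply_bcontfun x \<gamma> - J n x \<gamma>\<bar> \<le> \<delta> / 2" by blast
    obtain a where a: "a \<in> A" "p \<le> a" using A_inf unfolding infinite_nat_iff_unbounded_le by blast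
    have "finite {k. from_nat_into \<Gamma> k \<in> {\<gamma> \<in> \<Gamma>. node_rank \<gamma> < a}}"
      using bij_enum finite_vimageI[OF finite_below[of a], of "from_nat_into \<Gamma>"]
      by (simp add: bij_betw_def vimage_def)
    then have "\<forall>\<^sub>F k in sequentially. from_nat_into \<Gamma> k \<notin> {\<gamma> \<in> \<Gamma>. node_rank \<gamma> < a}"
      by (simp add: eventually_cofinite flip: cofinite_eq_sequentially)
    then show ?thesis
    proof (rule eventually_mono)
      fix k assume k: "from_nat_into \<Gamma> k \<notin> {\<gamma> \<in> \<Gamma>. node_rank \<gamma> < a}"
      have "from_nat_into \<Gamma> k \<in> \<Gamma>" using bij_enum by (auto simp: bij_betw_def)
      then have "p \<le> start (node_rank (from_nat_into \<Gamma> k))"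
        using k a start_ge[OF a(1), of "node_rank (from_nat_into \<Gamma> k)"] by auto
      then show "\<bar>apply_bcontfun (T x) k\<bar> < \<delta>"
        using p[of "start (node_rank (from_nat_into \<Gamma> k))" "from_nat_into \<Gamma> k"] that
        by (simp add: apply_T coord_def)
    qed
  qed
  then show ?thesis
    by (auto simp: c0_def tendsto_iff dist_real_def)
qed

text \<open>The unit vector at \<gamma> is extended from the ranks below the next element
  \<open>b\<close> of \<open>A\<close>. Blocks beginning before \<open>b\<close> begin no later than
  \<gamma>, so their initial projection kills the vector; from \<open>b\<close> on the initial
  projections fix it, and the coordinates vanish.\<close>

lemma unit_in_range:
  assumes "\<gamma> \<in> \<Gamma>"
  obtains u where "u \<in> X" "\<And>\<beta>. \<beta> \<in> \<Gamma> \<Longrightarrow> coord u \<beta> = indicator {\<gamma>} \<beta>"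
proof -
  define r where "r = node_rank \<gamma>"
  define b where "b = (LEAST a. a \<in> A \<and> r < a)"
  have "\<exists>a. a \<in> A \<and> r < a" using A_inf unfolding infinite_nat_iff_unbounded by blast
  then have b: "b \<in> A" "r < b" "\<And>a. a \<in> A \<Longrightarrow> r < a \<Longrightarrow> b \<le> a"
    unfolding b_def by (auto intro: LeastI2_ex Least_le)
  obtain u where u: "u \<in> span (dvec ` \<Gamma>)" "apply_bcontfun u = J b (indicator {\<gamma>})"
    using J_in_span by blast
  have "coord u \<beta> = indicator {\<gamma>} \<beta>" if \<beta>: "\<beta> \<in> \<Gamma>" for \<beta>
  proof (cases "node_rank \<beta> < b")
    case True
    have "start (node_rank \<beta>) \<le> r"
      using start_in[of "node_rank \<beta>"] start_le[of "node_rank \<beta>"] b(3) True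
      by (metis insertE leD le_less_trans linorder_not_less zero_le)
    then have "J (start (node_rank \<beta>)) (indicator {\<gamma>}) = J (start (node_rank \<beta>)) (\<lambda>_. 0)"
      by (intro J_cong) (auto simp: indicator_def r_def)
    moreover have "min (start (node_rank \<beta>)) b = start (node_rank \<beta>)"
      using start_le[of "node_rank \<beta>"] True by simp
    ultimately show ?thesis
      using True \<beta> by (simp add: coord_def u(2) J_J J_zero J_below)
  next
    case False
    then have "b \<le> start (node_rank \<beta>)" using start_ge[OF b(1)] by simp
    moreover have "\<beta> \<noteq> \<gamma>" using False b(2) by (auto simp: r_def)
    ultimately show ?thesis by (simp add: coord_def u(2) J_J min_def)
  qed
  then show ?thesis using that u(1) span_subset_X by blast
qed

text \<open>The image is closed, because \<open>T\<close> is bounded below on the complete space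
  \<open>X\<close>, and it contains the unit vectors of \<open>c0\<close>, whose span is
  dense.\<close>

lemma T_image: "T ` X = c0"
proof
  show "T ` X \<subseteq> c0" using T_in_c0 by blast
  interpret T: bounded_linear T by (rule bounded_linear_T)
  have sub: "subspace (T ` X)"
    by (intro linear_subspace_image T.linear_axioms subspace_X)
  define K where "K = (real N + \<theta>) / (1 - \<theta> * \<omega>) * (2 * C)"
  have K: "0 < K" using \<theta>\<omega> \<theta>_pos C_ge1 N_pos by (simp add: K_def)
  have "complete X"
    by (rule complete_closed_subset[OF _ _ complete_bcontfun_UNIV]) (simp_all add: BD_space_def)
  moreover have "\<forall>x\<in>X. 1 / K * norm x \<le> norm (T x)"
    using T_bounded_below[folded K_def] K by (simp add: field_simps)
  ultimately have "complete (T ` X)"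
    using K by (intro complete_isometric_image[OF _ subspace_X bounded_linear_T, of "1 / K"]) auto
  then have closed: "closed (T ` X)" by (rule complete_imp_closed)
  show "c0 \<subseteq> T ` X"
  proof
    fix z :: "nat \<Rightarrow>\<^sub>C real" assume "z \<in> c0"
    have "\<exists>u. u \<in> X \<and> (\<forall>\<beta>\<in>\<Gamma>. coord u \<beta> = indicator {from_nat_into \<Gamma> k} \<beta>)" for k
      using unit_in_range[of "from_nat_into \<Gamma> k"] bij_enum by (metis UNIV_I bij_betwE)
    then obtain u where u: "\<And>k. u k \<in> X"
      "\<And>k \<beta>. \<beta> \<in> \<Gamma> \<Longrightarrow> coord (u k) \<beta> = indicator {from_nat_into \<Gamma> k} \<beta>" by metis
    have Tu: "apply_bcontfun (T (u k)) j = (if j = k then 1 else 0)" for k j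
    proof -
      have "from_nat_into \<Gamma> j \<in> \<Gamma>" "from_nat_into \<Gamma> j = from_nat_into \<Gamma> k \<longleftrightarrow> j = k"
        using bij_enum by (auto simp: bij_betw_def inj_on_def)
      then show ?thesis using u(2)[of "from_nat_into \<Gamma> j" k] by (simp add: apply_T)
    qed
    have "z \<in> closure (T ` X)"
      unfolding closure_approachable
    proof (intro allI impI)
      fix \<epsilon> :: real assume "0 < \<epsilon>"
      then have "0 < \<epsilon> / 2" by simp
      then obtain n where n: "\<And>k. n \<le> k \<Longrightarrow> \<bar>apply_bcontfun z k\<bar> < \<epsilon> / 2"
        using \<open>z \<in> c0\<close> LIMSEQ_D[of "apply_bcontfun z" 0 "\<epsilon> / 2"] by (auto simp: c0_def)
      define y where "y = (\<Sum>k<n. apply_bcontfun z k *\<^sub>R T (u k))"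
      have y: "y \<in> T ` X"
        unfolding y_def using u(1) sub by (intro subspace_sum subspace_scale) auto
      have "apply_bcontfun y j = (if j < n then apply_bcontfun z j else 0)" for j
      proof -
        have "apply_bcontfun y j = (\<Sum>k<n. if j = k then apply_bcontfun z k else 0)"
          unfolding y_def apply_sum scaleR_bcontfun.rep_eq Tu by (intro sum.cong) auto
        then show ?thesis by simp
      qed
      then have "norm (y - z) \<le> \<epsilon> / 2"
        using n \<open>0 < \<epsilon>\<close> by (intro norm_bound) (auto simp: minus_bcontfun.rep_eq less_imp_le)
      then show "\<exists>y\<in>T ` X. dist y z < \<epsilon>"
        using y \<open>0 < \<epsilon>\<close> by (intro bexI[of _ y]) (auto simp: dist_norm)
    qed
    then show "z \<in> T ` X" using closed by simp
  qed
qed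

lemma isomorphic_c0: "isomorphic_subspaces X c0"
proof -
  have "0 < (real N + \<theta>) / (1 - \<theta> * \<omega>) * (2 * C)"
    using \<theta>\<omega> \<theta>_pos C_ge1 N_pos by simp
  from isomorphic_subspaces_bounded_below[OF bounded_linear_T subspace_X this T_bounded_below]
  show ?thesis by (simp add: T_image)
qed

end

section \<open>Ptak's combinatorial lemma\<close>

definition supp :: "('a \<Rightarrow> real) \<Rightarrow> 'a set" where
  "supp v = {j. v j \<noteq> 0}"

definition mass :: "('a \<Rightarrow> real) \<Rightarrow> 'a set \<Rightarrow> real" where
  "mass v B = (\<Sum>j\<in>B \<inter> supp v. v j)"

text \<open>Rationality is demanded because the vectors are finally turned into integer
  weights.\<close>

definition rat_prob :: "('a \<Rightarrow> real) set" where
  "rat_prob = {v. finite (supp v) \<and> (\<forall>j. 0 \<le> v j \<and> v j \<in> \<rat>) \<and> mass v UNIV = 1}"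

definition average :: "nat \<Rightarrow> (nat \<Rightarrow> 'a \<Rightarrow> real) \<Rightarrow> 'a \<Rightarrow> real" where
  "average k f j = (\<Sum>i<k. f i j) / real k"

text \<open>The classes within which small averages are sought: they are stable under averaging and
  reach arbitrarily far out, and both properties survive the restriction to tails and to vectors
  that are small on a small family.\<close>

definition rich :: "(nat \<Rightarrow> real) set \<Rightarrow> bool" where
  "rich V \<longleftrightarrow> V \<subseteq> rat_prob \<and> (\<forall>m. \<exists>v\<in>V. supp v \<subseteq> {m..}) \<and>
     (\<forall>k>0. \<forall>f. (\<forall>i<k. f i \<in> V) \<longrightarrow> average k f \<in> V)"

text \<open>Quantifying over all rich classes, rather than taking \<open>rat_prob\<close> alone,
  allows smallness on several families to be imposed one after another.\<close>

definition small_on :: "nat set set \<Rightarrow> bool" where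
  "small_on \<G> \<longleftrightarrow> (\<forall>V \<epsilon>. rich V \<longrightarrow> 0 < \<epsilon> \<longrightarrow> (\<exists>v\<in>V. \<forall>A\<in>\<G>. mass v A < \<epsilon>))"

lemma mass_superset:
  assumes "finite T" "supp v \<subseteq> T"
  shows "mass v B = (\<Sum>j\<in>T \<inter> B. v j)"
  unfolding mass_def using assms by (intro sum.mono_neutral_left) (auto simp: supp_def)

lemma supp_average: "supp (average k f) \<subseteq> (\<Union>i<k. supp (f i))"
proof
  fix j assume "j \<in> supp (average k f)"
  then have "(\<Sum>i<k. f i j) \<noteq> 0" by (auto simp: supp_def average_def)
  then obtain i where "i < k" "f i j \<noteq> 0" by (meson lessThan_iff sum.neutral)
  then show "j \<in> (\<Union>i<k. supp (f i))" by (auto simp: supp_def)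
qed

lemma mass_average:
  assumes "\<And>i. i < k \<Longrightarrow> finite (supp (f i))"
  shows "mass (average k f) B = (\<Sum>i<k. mass (f i) B) / real k"
proof -
  define T where "T = (\<Union>i<k. supp (f i))"
  have T: "finite T" "supp (average k f) \<subseteq> T" "\<And>i. i < k \<Longrightarrow> supp (f i) \<subseteq> T"
    using assms supp_average[of k f] by (auto simp: T_def)
  have "mass (average k f) B = (\<Sum>j\<in>T \<inter> B. \<Sum>i<k. f i j) / real k"
    by (simp add: mass_superset[OF T(1,2)] average_def sum_divide_distrib)
  also have "(\<Sum>j\<in>T \<inter> B. \<Sum>i<k. f i j) = (\<Sum>i<k. mass (f i) B)"
    by (subst sum.swap) (auto intro!: sum.cong simp: mass_superset[OF T(1,3)])
  finally show ?thesis .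
qed

lemma mass_le_1:
  assumes "v \<in> rat_prob"
  shows "mass v B \<le> 1"
proof -
  have "mass v B \<le> mass v UNIV"
    unfolding mass_def using assms by (intro sum_mono2) (auto simp: rat_prob_def)
  then show ?thesis using assms by (simp add: rat_prob_def)
qed

lemma average_rat_prob:
  assumes "0 < k" "\<And>i. i < k \<Longrightarrow> f i \<in> rat_prob"
  shows "average k f \<in> rat_prob"
proof -
  have "finite (supp (average k f))"
    using assms by (intro finite_subset[OF supp_average]) (auto simp: rat_prob_def)
  moreover have "mass (average k f) UNIV = 1"
    using assms by (subst mass_average) (auto simp: rat_prob_def)
  moreover have "0 \<le> average k f j \<and> average k f j \<in> \<rat>" for j
    using assms by (auto simp: average_def rat_prob_def intro!: divide_nonneg_nonneg sum_nonneg Rats_divide Rats_sum)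
  ultimately show ?thesis by (simp add: rat_prob_def)
qed

lemma rich_rat_prob: "rich rat_prob"
proof -
  have "\<exists>v\<in>rat_prob. supp v \<subseteq> {m..}" for m :: nat
    by (intro bexI[of _ "\<lambda>j. if j = m then 1 else 0"])
       (auto simp: rat_prob_def supp_def mass_def)
  then show ?thesis by (auto simp: rich_def intro: average_rat_prob)
qed

lemma rich_tail:
  assumes "rich V"
  shows "rich {v \<in> V. supp v \<subseteq> {m..}}"
proof -
  have ex: "\<exists>v\<in>V. supp v \<subseteq> {m..} \<and> supp v \<subseteq> {l..}" for l
  proof -
    obtain v where "v \<in> V" "supp v \<subseteq> {max m l..}"
      using assms unfolding rich_def by blast
    then show ?thesis by (intro bexI[of _ v]) (auto simp: subset_iff)
  qed
  have "supp (average k f) \<subseteq> {m..}" if "\<forall>i<k. supp (f i) \<subseteq> {m..}" for k f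
    using supp_average[of k f] that by blast
  moreover have "average k f \<in> V" if "0 < k" "\<forall>i<k. f i \<in> V" for k f
    using assms that unfolding rich_def by blast
  ultimately have avg: "average k f \<in> {v \<in> V. supp v \<subseteq> {m..}}"
    if "0 < k" "\<forall>i<k. f i \<in> {v \<in> V. supp v \<subseteq> {m..}}" for k f using that by auto
  show ?thesis
    unfolding rich_def
  proof (intro conjI allI impI)
    show "\<exists>v\<in>{v \<in> V. supp v \<subseteq> {m..}}. supp v \<subseteq> {l..}" for l using ex[of l] by auto
  qed (use avg assms in \<open>auto simp: rich_def\<close>)
qed

text \<open>Smallness passes to averages, and applying it to the tails of \<open>V\<close>, which
  are rich, gives small vectors arbitrarily far out.\<close>

lemma rich_small:
  assumes "rich V" "small_on \<G>" "0 < \<epsilon>"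
  shows "rich {v \<in> V. \<forall>A\<in>\<G>. mass v A < \<epsilon>}"
proof -
  have ex: "\<exists>v\<in>V. (\<forall>A\<in>\<G>. mass v A < \<epsilon>) \<and> supp v \<subseteq> {m..}" for m
    using assms(2,3) rich_tail[OF assms(1), of m] unfolding small_on_def by blast
  have "mass (average k f) A < \<epsilon>"
    if k: "0 < k" and f: "\<forall>i<k. f i \<in> V \<and> (\<forall>A\<in>\<G>. mass (f i) A < \<epsilon>)" and A: "A \<in> \<G>" for k f A
  proof -
    have "(\<Sum>i<k. mass (f i) A) < (\<Sum>i<k. \<epsilon>)"
      using k f A by (intro sum_strict_mono) auto
    moreover have "mass (average k f) A = (\<Sum>i<k. mass (f i) A) / real k"
      using assms(1) f by (intro mass_average) (auto simp: rich_def rat_prob_def)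
    ultimately show ?thesis using k by (simp add: divide_less_eq mult.commute)
  qed
  moreover have "average k f \<in> V" if "0 < k" "\<forall>i<k. f i \<in> V" for k f
    using assms that unfolding rich_def by blast
  ultimately have avg: "average k f \<in> {v \<in> V. \<forall>A\<in>\<G>. mass v A < \<epsilon>}"
    if "0 < k" "\<forall>i<k. f i \<in> {v \<in> V. \<forall>A\<in>\<G>. mass v A < \<epsilon>}" for k f using that by auto
  show ?thesis
    unfolding rich_def
  proof (intro conjI allI impI)
    show "\<exists>v\<in>{v \<in> V. \<forall>A\<in>\<G>. mass v A < \<epsilon>}. supp v \<subseteq> {m..}" for m using ex[of m] by auto
  qed (use avg assms(1) in \<open>auto simp: rich_def\<close>)
qed

lemma small_on_empty: "small_on {}"
  unfolding small_on_def rich_def by blast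

lemma small_on_Un:
  assumes "small_on \<G>" "small_on \<H>"
  shows "small_on (\<G> \<union> \<H>)"
  unfolding small_on_def
proof (intro allI impI)
  fix V and \<epsilon> :: real assume "rich V" "0 < \<epsilon>"
  then have "rich {v \<in> V. \<forall>A\<in>\<G>. mass v A < \<epsilon>}" using rich_small assms(1) by blast
  then obtain v where "v \<in> V" "\<forall>A\<in>\<G>. mass v A < \<epsilon>" "\<forall>A\<in>\<H>. mass v A < \<epsilon>"
    using assms(2) \<open>0 < \<epsilon>\<close> unfolding small_on_def by blast
  then show "\<exists>v\<in>V. \<forall>A\<in>\<G> \<union> \<H>. mass v A < \<epsilon>" by blast
qed

lemma small_on_UN: "finite I \<Longrightarrow> (\<And>i. i \<in> I \<Longrightarrow> small_on (\<G> i)) \<Longrightarrow> small_on (\<Union>i\<in>I. \<G> i)"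
  by (induction I rule: finite_induct) (auto simp: small_on_empty intro!: small_on_Un)

text \<open>Average a sequence in which every term is small on the sets that meet the support of an earlier
  term: a set carries at most the full mass of the first term it meets.\<close>

lemma small_on_step:
  assumes "\<And>n. m \<le> n \<Longrightarrow> small_on {A \<in> \<G>. n \<in> A}"
  shows "small_on \<G>"
  unfolding small_on_def
proof (intro allI impI)
  fix V and \<epsilon> :: real assume V: "rich V" and \<epsilon>: "0 < \<epsilon>"
  \<comment> \<open>The second component of a state is the newest term; the first accumulates the
    supports of all terms so far.\<close>
  define P where "P = (\<lambda>(T, v). v \<in> V \<and> finite T \<and> T \<subseteq> {m..} \<and> supp v \<subseteq> T)"
  define Q where "Q = (\<lambda>(T, v :: nat \<Rightarrow> real) (T', v'). T' = T \<union> supp v' \<and> (\<forall>A\<in>\<G>. A \<inter> T \<noteq> {} \<longrightarrow> mass v' A < \<epsilon> / 2))"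
  have fin: "finite (supp v)" if "v \<in> V" for v
    using V that by (auto simp: rich_def rat_prob_def)
  have "\<exists>s. \<forall>i. P (s i) \<and> Q (s i) (s (Suc i))"
  proof (rule dependent_nat_choice)
    obtain v where "v \<in> V" "supp v \<subseteq> {m..}" using V unfolding rich_def by blast
    then show "\<exists>s. P s" using fin by (intro exI[of _ "(supp v, v)"]) (auto simp: P_def)
  next
    fix s and i :: nat assume "P s"
    then obtain T v where s: "s = (T, v)" "v \<in> V" "finite T" "T \<subseteq> {m..}" "supp v \<subseteq> T"
      by (auto simp: P_def)
    \<comment> \<open>The sets meeting \<open>T\<close> form a finite union of families covered by
      the assumption, as \<open>T\<close> is finite and contained in \<open>{m..}\<close>.\<close>
    have "small_on (\<Union>n\<in>T. {A \<in> \<G>. n \<in> A})"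
      using s assms by (intro small_on_UN) auto
    then obtain v' where v': "v' \<in> V" "supp v' \<subseteq> {m..}" "\<forall>A\<in>(\<Union>n\<in>T. {A \<in> \<G>. n \<in> A}). mass v' A < \<epsilon> / 2"
      using rich_tail[OF V, of m] \<epsilon> unfolding small_on_def by (metis (no_types, lifting) half_gt_zero mem_Collect_eq)
    then show "\<exists>s'. P s' \<and> Q s s'"
      using s fin by (intro exI[of _ "(T \<union> supp v', v')"]) (auto simp: P_def Q_def)
  qed
  then obtain s where s: "\<And>i. P (s i)" "\<And>i. Q (s i) (s (Suc i))" by blast
  define T where "T i = fst (s i)" for i
  define f where "f i = snd (s i)" for i
  have f: "f i \<in> V" "supp (f i) \<subseteq> T i" for i
    using s(1)[of i] by (auto simp: P_def T_def f_def split: prod.splits)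
  have T: "T (Suc i) = T i \<union> supp (f (Suc i))" for i
    using s(2)[of i] by (auto simp: Q_def T_def f_def split: prod.splits)
  have small: "mass (f (Suc i)) A < \<epsilon> / 2" if "A \<in> \<G>" "A \<inter> T i \<noteq> {}" for A i
    using s(2)[of i] that by (auto simp: Q_def T_def f_def split: prod.splits)
  have le1: "mass (f i) A \<le> 1" for i A
    using f V by (intro mass_le_1) (auto simp: rich_def)
  have mass0: "mass (f i) A = 0" if "A \<inter> T i = {}" for i A
    using that f(2)[of i] by (simp add: mass_def disjoint_iff subset_iff) (meson Int_iff sum.neutral)
  have sum: "(\<Sum>i\<le>k. mass (f i) A) \<le> (if A \<inter> T k = {} then 0 else 1 + real k * (\<epsilon> / 2))" if "A \<in> \<G>" for A k
  proof (induction k)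
    case 0
    then show ?case using le1 mass0 by auto
  next
    case (Suc k)
    have step: "1 + real (Suc k) * (\<epsilon> / 2) = 1 + real k * (\<epsilon> / 2) + \<epsilon> / 2" "0 \<le> real k * (\<epsilon> / 2)"
      using \<epsilon> by (simp_all add: field_simps)
    consider "A \<inter> T (Suc k) = {}" | "A \<inter> T (Suc k) \<noteq> {}" "A \<inter> T k = {}" | "A \<inter> T k \<noteq> {}" by blast
    then show ?case
    proof cases
      case 1
      then have "A \<inter> T k = {}" using T[of k] by blast
      then show ?thesis using Suc 1 mass0[OF 1] by simp
    next
      case 2
      then have "(\<Sum>i\<le>k. mass (f i) A) \<le> 0" using Suc by simp
      then have "(\<Sum>i\<le>Suc k. mass (f i) A) \<le> 1 + real (Suc k) * (\<epsilon> / 2)"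
        using le1[of "Suc k" A] step \<epsilon> unfolding sum.atMost_Suc by linarith
      then show ?thesis using 2 by simp
    next
      case 3
      then have "A \<inter> T (Suc k) \<noteq> {}" using T[of k] by blast
      have "(\<Sum>i\<le>k. mass (f i) A) \<le> 1 + real k * (\<epsilon> / 2)" using Suc 3 by simp
      then have "(\<Sum>i\<le>Suc k. mass (f i) A) \<le> 1 + real (Suc k) * (\<epsilon> / 2)"
        using small[OF that 3] step unfolding sum.atMost_Suc by linarith
      then show ?thesis using \<open>A \<inter> T (Suc k) \<noteq> {}\<close> by simp
    qed
  qed
  \<comment> \<open>An average of \<open>k + 1\<close> terms has mass at most
    \<open>(1 + k * \<epsilon> / 2) / (k + 1)\<close>, so the single full mass costs less than the
    remaining half of \<epsilon>.\<close>
  obtain k where k: "1 / real (Suc k) < \<epsilon> / 2"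
    using \<epsilon> by (metis half_gt_zero nat_approx_posE)
  show "\<exists>v\<in>V. \<forall>A\<in>\<G>. mass v A < \<epsilon>"
  proof (intro bexI ballI)
    show "average (Suc k) f \<in> V" using V f(1) unfolding rich_def by blast
    fix A assume "A \<in> \<G>"
    have "0 \<le> 1 + real k * (\<epsilon> / 2)" using \<epsilon> by (intro add_nonneg_nonneg) auto
    then have "(\<Sum>i<Suc k. mass (f i) A) \<le> 1 + real k * (\<epsilon> / 2)"
      using sum[OF \<open>A \<in> \<G>\<close>, of k] unfolding lessThan_Suc_atMost by (smt (verit))
    also have "\<dots> < real (Suc k) * \<epsilon>"
      using k \<epsilon> by (simp add: field_simps)
    finally show "mass (average (Suc k) f) A < \<epsilon>"
      using f(1) fin by (subst mass_average) (auto simp: field_simps)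
  qed
qed

text \<open>If smallness fails for the members containing a finite \<open>s\<close>, then by
  \<open>small_on_step\<close> it still fails for those containing one further, larger point.
  Iteration builds an infinite set all of whose finite subsets lie in members of the family.\<close>

lemma small_on_if_no_branch:
  assumes "\<And>S. infinite S \<Longrightarrow> \<exists>F\<subseteq>S. finite F \<and> \<not> (\<exists>A\<in>\<G>. F \<subseteq> A)"
  shows "small_on \<G>"
proof (rule ccontr)
  assume "\<not> small_on \<G>"
  define P where "P s \<longleftrightarrow> finite s \<and> \<not> small_on {A \<in> \<G>. s \<subseteq> A}" for s
  have "\<exists>f. \<forall>i::nat. P (f i) \<and> (\<exists>n. (\<forall>j\<in>f i. j < n) \<and> f (Suc i) = insert n (f i))"
  proof (rule dependent_nat_choice)
    show "\<exists>s. P s" using \<open>\<not> small_on \<G>\<close> by (intro exI[of _ "{}"]) (simp add: P_def)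
  next
    fix s and i :: nat assume "P s"
    then obtain m where m: "\<forall>j\<in>s. j < m"
      unfolding P_def by (metis finite_nat_set_iff_bounded)
    have "\<exists>n\<ge>m. \<not> small_on {A \<in> {A \<in> \<G>. s \<subseteq> A}. n \<in> A}"
      using small_on_step[of m "{A \<in> \<G>. s \<subseteq> A}"] \<open>P s\<close> by (auto simp: P_def)
    then obtain n where "m \<le> n" "\<not> small_on {A \<in> {A \<in> \<G>. s \<subseteq> A}. n \<in> A}" by blast
    moreover have "{A \<in> {A \<in> \<G>. s \<subseteq> A}. n \<in> A} = {A \<in> \<G>. insert n s \<subseteq> A}" by auto
    ultimately have "P (insert n s)" "\<forall>j\<in>s. j < n"
      using m \<open>P s\<close> by (auto simp: P_def)
    then show "\<exists>t. P t \<and> (\<exists>n. (\<forall>j\<in>s. j < n) \<and> t = insert n s)" by blast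
  qed
  then obtain f where f: "\<And>i. P (f i)" "\<And>i. \<exists>n. (\<forall>j\<in>f i. j < n) \<and> f (Suc i) = insert n (f i)"
    by blast
  have mono: "f i \<subseteq> f j" if "i \<le> j" for i j
    using that by (induction rule: dec_induct) (use f(2) in blast)+
  have card: "card (f i) \<ge> i" for i
  proof (induction i)
    case (Suc i)
    obtain n where "\<forall>j\<in>f i. j < n" "f (Suc i) = insert n (f i)" using f(2) by blast
    moreover from this have "n \<notin> f i" by blast
    ultimately show ?case using Suc f(1)[of i] by (simp add: P_def)
  qed simp
  have inf: "infinite (\<Union>i. f i)"
  proof
    assume fin: "finite (\<Union>i. f i)"
    have "card (f (Suc (card (\<Union>i. f i)))) \<le> card (\<Union>i. f i)"
      using fin by (intro card_mono) auto
    then show False using card[of "Suc (card (\<Union>i. f i))"] by simp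
  qed
  then obtain F where F: "F \<subseteq> (\<Union>i. f i)" "finite F" "\<not> (\<exists>A\<in>\<G>. F \<subseteq> A)"
    using assms[OF inf] by metis
  have "\<exists>k. F \<subseteq> f k"
    using F(2,1)
  proof (induction rule: finite_induct)
    case (insert x F)
    then obtain k i where "F \<subseteq> f k" "x \<in> f i" by auto
    then have "insert x F \<subseteq> f (max k i)" using mono[of k "max k i"] mono[of i "max k i"] by auto
    then show ?case ..
  qed simp
  then obtain k where "F \<subseteq> f k" ..
  \<comment> \<open>A finite set contained in no member would leave the empty family at stage
    \<open>k\<close>, on which smallness holds trivially.\<close>
  then have eq: "{A \<in> \<G>. f k \<subseteq> A} = {}" using F(3) by blast
  show False using f(1)[of k] small_on_empty unfolding P_def eq by blast
qed

lemma common_denominator: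
  fixes v :: "'a \<Rightarrow> real"
  assumes "finite T" "\<And>j. j \<in> T \<Longrightarrow> v j \<in> \<rat> \<and> 0 \<le> v j"
  shows "\<exists>D>0. \<forall>j\<in>T. \<exists>n. real D * v j = real n"
  using assms
proof (induction rule: finite_induct)
  case empty
  then show ?case by auto
next
  case (insert x T)
  then obtain D where D: "D > 0" "\<forall>j\<in>T. \<exists>n. real D * v j = real n" by auto
  obtain a b where ab: "b \<noteq> 0" "\<bar>v x\<bar> = real a / real b"
    using insert.prems[of x] Rats_abs_nat_div_natE by (metis insertI1)
  have *: "\<exists>n. real (D * b) * v j = real n" if "j \<in> insert x T" for j
  proof (cases "j = x")
    case True
    then have "real (D * b) * v j = real (D * a)"
      using ab insert.prems[of x] by simp
    then show ?thesis ..
  next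
    case False
    then have "j \<in> T" using that by simp
    then obtain n where "real D * v j = real n" using D(2) by metis
    have "real (D * b) * v j = real b * (real D * v j)" by (simp only: of_nat_mult mult_ac)
    also have "\<dots> = real (b * n)" using \<open>real D * v j = real n\<close> by simp
    finally have "real (D * b) * v j = real (b * n)" .
    then show ?thesis ..
  qed
  show ?case using * D(1) ab(1) by (intro exI[of _ "D * b"]) auto
qed

text \<open>A rational vector of small mass, multiplied by a common denominator of its values, gives
  integer weights whose total is that denominator.\<close>

lemma ptak:
  assumes "\<And>S. infinite S \<Longrightarrow> \<exists>F\<subseteq>S. finite F \<and> \<not> (\<exists>A\<in>\<G>. F \<subseteq> A)" "0 < \<epsilon>"
  obtains T and w :: "nat \<Rightarrow> nat" where "finite T" "0 < sum w T"
    "\<And>A. A \<in> \<G> \<Longrightarrow> real (sum w (T \<inter> A)) < \<epsilon> * real (sum w T)"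
proof -
  have "small_on \<G>"
    using assms(1) by (rule small_on_if_no_branch)
  then obtain v where v: "v \<in> rat_prob" "\<And>A. A \<in> \<G> \<Longrightarrow> mass v A < \<epsilon>"
    using rich_rat_prob assms(2) unfolding small_on_def by blast
  define T where "T = supp v"
  have T: "finite T" and nonneg: "\<And>j. v j \<in> \<rat> \<and> 0 \<le> v j" using v(1) by (auto simp: T_def rat_prob_def)
  obtain D where D: "D > 0" "\<forall>j\<in>T. \<exists>n. real D * v j = real n"
    using common_denominator[OF T, of v] nonneg by blast
  then obtain w where w: "\<And>j. j \<in> T \<Longrightarrow> real D * v j = real (w j)" by metis
  have sum: "real (sum w (T \<inter> A)) = real D * mass v A" for A
    using w by (simp add: mass_superset[OF T, of v A] T_def sum_distrib_left)
  have "mass v UNIV = 1" using v(1) by (simp add: rat_prob_def)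
  then have D': "real (sum w T) = real D" using sum[of UNIV] by simp
  show ?thesis
  proof (rule that[OF T])
    show "0 < sum w T" using D' D(1) by (metis of_nat_0_less_iff)
    show "real (sum w (T \<inter> A)) < \<epsilon> * real (sum w T)" if "A \<in> \<G>" for A
      using sum[of A] D' D(1) v(2)[OF that] by simp
  qed
qed

section \<open>The case of a compact family of finite sets\<close>

text \<open>Otherwise the sets \<open>c i\<close> with \<open>i\<close> in \<open>S\<close> have the
  finite intersection property on the compact family. Some member then meets infinitely many
  disjoint sets \<open>E i\<close>, contradicting its finiteness.\<close>

lemma compact_family_no_branch:
  assumes "compact_family \<M>" "\<And>A. A \<in> \<M> \<Longrightarrow> finite A"
    and E: "\<And>i. finite (E i)" "\<And>i j. i \<noteq> j \<Longrightarrow> E i \<inter> E j = {}" and S: "infinite (S :: nat set)"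
  shows "\<exists>F\<subseteq>S. finite F \<and> \<not> (\<exists>A\<in>\<M>. F \<subseteq> {i. E i \<inter> A \<noteq> {}})"
proof (rule ccontr)
  assume not: "\<not> ?thesis"
  define K where "K = (\<lambda>A n. n \<in> A) ` \<M>"
  define c :: "nat \<Rightarrow> (nat \<Rightarrow> bool) set" where "c i = {\<phi>. \<exists>e\<in>E i. \<phi> e}" for i
  \<comment> \<open>A finite union of closed cylinders, since \<open>E i\<close> is finite.\<close>
  have closed: "closed (c i)" for i
  proof -
    have "closed ((\<lambda>\<phi> :: nat \<Rightarrow> bool. \<phi> e) -` {True})" for e
      by (intro closed_vimage continuous_on_product_coordinates) simp
    moreover have "c i = (\<Union>e\<in>E i. (\<lambda>\<phi> :: nat \<Rightarrow> bool. \<phi> e) -` {True})" by (auto simp: c_def)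
    ultimately show ?thesis using E(1)[of i] by (auto intro!: closed_UN)
  qed
  have fip: "K \<inter> \<Inter>\<C> \<noteq> {}" if "finite \<C>" "\<C> \<subseteq> c ` S" for \<C>
  proof -
    have "\<exists>F\<subseteq>S. finite F \<and> \<C> = c ` F" using that by (rule finite_subset_image)
    then obtain F where F: "F \<subseteq> S" "finite F" "\<C> = c ` F" by blast
    then obtain A where "A \<in> \<M>" "F \<subseteq> {i. E i \<inter> A \<noteq> {}}" using not by blast
    then have "(\<lambda>n. n \<in> A) \<in> K \<inter> \<Inter>\<C>" using F by (auto simp: K_def c_def)
    then show ?thesis by blast
  qed
  have "compact K" using assms(1) by (simp add: compact_family_def K_def)
  then have "K \<inter> \<Inter>(c ` S) \<noteq> {}"
  proof (rule compact_imp_fip)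
    show "closed T" if "T \<in> c ` S" for T using that closed by blast
  qed (rule fip)
  then obtain A where A: "A \<in> \<M>" "\<forall>i\<in>S. \<exists>e\<in>E i. e \<in> A" by (auto simp: K_def c_def)
  then obtain e where e: "\<forall>i\<in>S. e i \<in> E i \<and> e i \<in> A" by metis
  have "inj_on e S" using e E(2) by (metis (no_types, lifting) Int_iff empty_iff inj_onI)
  moreover have "e ` S \<subseteq> A" using e by auto
  ultimately show False
    using S assms(2)[OF A(1)] by (meson finite_imageD finite_subset)
qed

section \<open>Growth of block sums under repeated averaging\<close>

locale bd_blocks = bd_param +
  fixes b :: "nat \<Rightarrow> node \<Rightarrow> real" and n :: "nat \<Rightarrow> nat"
  assumes \<omega>_pos: "0 < \<omega>" and \<M>: "compact_family \<M>" "\<And>A. A \<in> \<M> \<Longrightarrow> finite A"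
    and n: "strict_mono n"
    and b_start: "\<And>k. J (n k) (b k) = (\<lambda>_. 0)" and b_end: "\<And>k. J (n (Suc k)) (b k) = b k"
begin

definition z :: "nat set \<Rightarrow> node \<Rightarrow> real" where
  "z F = (\<lambda>\<gamma>. \<Sum>k\<in>F. b k \<gamma>)"

lemma J_b_zero: "m \<le> n k \<Longrightarrow> J m (b k) = (\<lambda>_. 0)"
  using J_J[of m "n k" "b k"] by (simp add: b_start J_zero min_def)

lemma J_b_self: "n (Suc k) \<le> m \<Longrightarrow> J m (b k) = b k"
  using J_J[of m "n (Suc k)" "b k"] by (simp add: b_end)

lemma J_z_self: "(\<And>k. k \<in> F \<Longrightarrow> n (Suc k) \<le> m) \<Longrightarrow> J m (z F) = z F"
  by (simp add: z_def J_sum J_b_self cong: sum.cong)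

lemma J_n_z:
  assumes "finite F"
  shows "J (n l) (z F) = z (F \<inter> {..<l})"
proof -
  have "J (n l) (b k) = (if k < l then b k else (\<lambda>_. 0))" for k
    using n by (auto intro!: J_b_zero J_b_self simp: strict_mono_less_eq)
  then have "J (n l) (z F) = (\<lambda>\<gamma>. \<Sum>k\<in>F. if k \<in> {..<l} then b k \<gamma> else 0)"
    by (auto simp: z_def J_sum fun_eq_iff intro!: sum.cong)
  then show ?thesis using assms by (simp add: z_def sum.inter_restrict)
qed

lemma z_Un: "finite F \<Longrightarrow> finite G \<Longrightarrow> F \<inter> G = {} \<Longrightarrow> z (F \<union> G) \<gamma> = z F \<gamma> + z G \<gamma>"
  by (simp add: z_def sum.union_disjoint)

text \<open>Requiring sums beyond every index \<open>m\<close> allows a construction to be continued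
  past any stage already reached.\<close>

definition attains :: "real \<Rightarrow> bool" where
  "attains a \<longleftrightarrow> (\<forall>m. \<exists>F\<subseteq>{m..}. finite F \<and> (\<exists>\<eta>\<in>\<Gamma>. a \<le> z F \<eta>))"

lemma adm_mono: "adm q I G ts \<Longrightarrow> I \<subseteq> I' \<Longrightarrow> adm q I' G ts"
  unfolding admissible_def by fast

text \<open>Successive block sums with value at least \<open>a\<close> at nodes
  \<open>\<eta> i\<close> occupy disjoint rank intervals \<open>E i\<close>. Ptak's lemma weights
  these intervals admissibly, and the average of total weight \<open>q + 1\<close> then has value at
  least \<open>\<theta> / N * a\<close>.\<close>

lemma weighted_attained:
  assumes "attains a"
  shows "\<exists>F\<subseteq>{m..}. finite F \<and> (\<exists>q\<ge>r. (\<forall>k\<in>F. n (Suc k) \<le> Suc q) \<and>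
    (\<exists>ts. adm q {m..q} (\<Gamma>upto q) ts \<and> \<theta> / real N * a \<le> W q ts (z F)))"
proof -
  have "\<forall>m. \<exists>F \<eta>. F \<subseteq> {m..} \<and> finite F \<and> \<eta> \<in> \<Gamma> \<and> a \<le> z F \<eta>"
    using assms unfolding attains_def by blast
  then obtain G H where GH: "\<And>m. G m \<subseteq> {m..}" "\<And>m. finite (G m)" "\<And>m. H m \<in> \<Gamma>" "\<And>m. a \<le> z (G m) (H m)"
    by metis
  \<comment> \<open>The next starting index lies past \<open>l\<close> and past all of
    \<open>G l\<close>; the insertion keeps \<open>Max\<close> meaningful when \<open>G l\<close> is
    empty.\<close>
  define nxt where "nxt l = Suc (Max (insert l (G l)))" for l
  have nxt: "l < nxt l" "G l \<subseteq> {l..<nxt l}" for l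
    using GH(1)[of l] GH(2)[of l] by (auto simp: nxt_def less_Suc_eq_le)
  define s where "s i = (nxt ^^ i) m" for i
  have s_Suc: "s (Suc i) = nxt (s i)" for i by (simp add: s_def)
  have s: "strict_mono s" using nxt(1) by (simp add: strict_mono_Suc_iff s_Suc)
  have ns: "strict_mono (\<lambda>i. n (s i))" using n s by (simp add: strict_mono_def)
  define F where "F i = G (s i)" for i
  define \<eta> where "\<eta> i = H (s i)" for i
  \<comment> \<open>The ranks occupied by the blocks with indices from \<open>s i\<close> up to
    \<open>s (Suc i) - 1\<close>, among which are those of \<open>F i\<close>.\<close>
  define E where "E i = {n (s i)..n (s (Suc i)) - 1}" for i
  have F: "F i \<subseteq> {s i..<s (Suc i)}" "finite (F i)" for i
    using nxt(2)[of "s i"] GH(2) by (auto simp: F_def s_Suc)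
  have \<eta>: "\<eta> i \<in> \<Gamma>" "a \<le> z (F i) (\<eta> i)" for i using GH(3,4) by (auto simp: \<eta>_def F_def)
  have E_less: "n (s i) < n (s (Suc i))" for i using ns by (simp add: strict_mono_def)
  have E_ordered: "x < y" if "i < j" "x \<in> E i" "y \<in> E j" for i j x y
  proof -
    have "n (s (Suc i)) \<le> n (s j)" using ns that(1) by (simp add: strict_mono_less_eq[OF ns])
    moreover have "x < n (s (Suc i))" "n (s j) \<le> y" using that E_less[of i] by (auto simp: E_def)
    ultimately show ?thesis by simp
  qed
  have E_disj: "E i \<inter> E j = {}" if "i \<noteq> j" for i j
    using that E_ordered[of i j] E_ordered[of j i] by (metis disjoint_iff less_irrefl linorder_neqE_nat)
  have MM: "Min (E i) = n (s i)" "Suc (Max (E i)) = n (s (Suc i))" for i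
  proof -
    have "Max (E i) = n (s (Suc i)) - 1" "Min (E i) = n (s i)"
      using E_less[of i] unfolding E_def by (auto intro: Max_eqI Min_eqI)
    then show "Min (E i) = n (s i)" "Suc (Max (E i)) = n (s (Suc i))" using E_less[of i] by auto
  qed
  \<comment> \<open>Ptak's lemma is applied to sets of interval indices: each \<open>A\<close> is
    replaced by the set of all \<open>i\<close> for which \<open>E i\<close> meets it.\<close>
  have "\<exists>F\<subseteq>S. finite F \<and> \<not> (\<exists>B\<in>(\<lambda>A. {i. E i \<inter> A \<noteq> {}}) ` \<M>. F \<subseteq> B)" if "infinite S" for S
    using compact_family_no_branch[OF \<M>, of E S] E_disj that by (auto simp: E_def)
  then obtain T w where T: "finite T" "0 < sum w T"
    and w: "\<And>B. B \<in> (\<lambda>A. {i. E i \<inter> A \<noteq> {}}) ` \<M> \<Longrightarrow> real (sum w (T \<inter> B)) < \<omega> * real (sum w T)"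
    using \<omega>_pos ptak[of "(\<lambda>A. {i. E i \<inter> A \<noteq> {}}) ` \<M>" \<omega>] by metis
  define D where "D = sum w T"
  define t where "t = Suc (r + (\<Sum>i\<in>T. node_rank (\<eta> i) + n (s (Suc i))))"
  \<comment> \<open>Multiplying the weights by \<open>t\<close> makes them add up to \<open>q + 1\<close> with \<open>q\<close> above all ranks involved.\<close>
  define q where "q = D * t - 1"
  have "D \<ge> 1" using T by (simp add: D_def)
  then have Sq: "Suc q = D * t" and tq: "t \<le> Suc q"
    using mult_le_mono1[of 1 D t] by (simp_all add: q_def t_def)
  have rank: "node_rank (\<eta> i) + n (s (Suc i)) \<le> q" if "i \<in> T" for i
    using member_le_sum[OF that, of "\<lambda>i. node_rank (\<eta> i) + n (s (Suc i))"] T(1) tq by (simp add: t_def)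
  define ts where "ts = map (\<lambda>i. (1::int, E i, \<eta> i, t * w i)) (sorted_list_of_set T)"
  have set_ts: "set ts = (\<lambda>i. (1, E i, \<eta> i, t * w i)) ` T" using T by (simp add: ts_def)
  have sum_ts: "(\<Sum>x\<leftarrow>ts. f x) = (\<Sum>i\<in>T. f (1, E i, \<eta> i, t * w i))" for f :: "_ \<Rightarrow> 'c::comm_monoid_add"
    using T by (simp add: ts_def o_def sum_list_distinct_conv_sum_set)
  have m_le: "m \<le> n (s i)" for i
  proof -
    have "m \<le> s i" using strict_mono_less_eq[OF s, of 0 i] by (simp add: s_def)
    also have "s i \<le> n (s i)" using n by (rule strict_mono_imp_increasing)
    finally show ?thesis .
  qed
  have "adm q {m..q} (\<Gamma>upto q) ts"
    unfolding admissible_def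
  proof (intro conjI)
    show "ts \<noteq> []" using T by (auto simp: ts_def)
    have "interval (E i)" for i
      unfolding interval_def E_def using E_less[of i]
      by (intro exI[of _ "n (s i)"] exI[of _ "n (s (Suc i)) - 1"]) auto
    moreover have "E i \<subseteq> {m..q}" "\<eta> i \<in> \<Gamma>upto q" if "i \<in> T" for i
      using rank[OF that] \<eta>(1) m_le[of i] by (auto simp: E_def Gamma_iff)
    ultimately show "\<forall>(\<epsilon>, E, \<eta>, h)\<in>set ts. \<epsilon> \<in> {-1, 1} \<and> interval E \<and> E \<subseteq> {m..q} \<and> \<eta> \<in> \<Gamma>upto q"
      by (auto simp: set_ts)
    show "sorted_wrt (\<lambda>(_, E, _, _) (_, E', _, _). \<forall>a\<in>E. \<forall>b\<in>E'. a < b) ts"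
      unfolding ts_def sorted_wrt_map
      by (rule sorted_wrt_mono_rel[OF _ strict_sorted_list_of_set]) (auto intro: E_ordered)
    show "(\<Sum>(\<epsilon>, E, \<eta>, h)\<leftarrow>ts. h) \<le> q + 1"
      using Sq by (simp add: sum_ts D_def sum_distrib_left mult.commute)
    show "\<forall>A\<in>\<M>. real (\<Sum>(\<epsilon>, E, \<eta>, h)\<leftarrow>ts. if E \<inter> A \<noteq> {} then h else 0) < \<omega> * real (q + 1)"
    proof
      fix A assume "A \<in> \<M>"
      then have "real (sum w (T \<inter> {i. E i \<inter> A \<noteq> {}})) < \<omega> * real D"
        using w unfolding D_def by blast
      then have "real t * real (sum w (T \<inter> {i. E i \<inter> A \<noteq> {}})) < real t * (\<omega> * real D)"
        by (rule mult_strict_left_mono) (simp only: of_nat_0_less_iff t_def zero_less_Suc)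
      also have "\<dots> = \<omega> * real (q + 1)" using Sq by (metis Suc_eq_plus1 mult.assoc mult.commute of_nat_mult)
      also have "real t * real (sum w (T \<inter> {i. E i \<inter> A \<noteq> {}})) =
          real (\<Sum>(\<epsilon>, E, \<eta>, h)\<leftarrow>ts. if E \<inter> A \<noteq> {} then h else 0)"
        using T(1) by (simp add: sum_ts sum.inter_restrict sum_distrib_left if_distrib cong: if_cong)
      finally show "real (\<Sum>(\<epsilon>, E, \<eta>, h)\<leftarrow>ts. if E \<inter> A \<noteq> {} then h else 0) < \<omega> * real (q + 1)" .
    qed
  qed
  moreover define FF where "FF = (\<Union>i\<in>T. F i)"
  have finFF: "finite FF" using T F by (simp add: FF_def)
  \<comment> \<open>The index ranges of different sets \<open>F j\<close> are disjoint, so cutting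
    \<open>FF\<close> to the range belonging to \<open>E i\<close> leaves exactly
    \<open>F i\<close>.\<close>
  have PE: "PE (E i) (z FF) = z (F i)" if "i \<in> T" for i
  proof -
    have "F j \<inter> {s i..<s (Suc i)} = {}" if "j \<noteq> i" for j
    proof (cases "j < i")
      case True
      then show ?thesis using F(1)[of j] strict_mono_less_eq[OF s, of "Suc j" i] by fastforce
    next
      case False
      then show ?thesis using F(1)[of j] strict_mono_less_eq[OF s, of "Suc i" j] that by fastforce
    qed
    then have "F j \<inter> {s i..<s (Suc i)} \<subseteq> F i" for j by (cases "j = i") auto
    then have "FF \<inter> {s i..<s (Suc i)} = F i" using F(1)[of i] that by (fastforce simp: FF_def)
    moreover have "s i \<le> s (Suc i)" using s by (simp add: strict_mono_less_eq)
    then have "FF \<inter> {..<s (Suc i)} = (FF \<inter> {..<s i}) \<union> (FF \<inter> {s i..<s (Suc i)})" by auto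
    ultimately have FF: "FF \<inter> {..<s (Suc i)} = (FF \<inter> {..<s i}) \<union> F i" by simp
    have "(FF \<inter> {..<s i}) \<inter> F i = {}" using F(1)[of i] by fastforce
    then have "z ((FF \<inter> {..<s i}) \<union> F i) \<gamma> = z (FF \<inter> {..<s i}) \<gamma> + z (F i) \<gamma>" for \<gamma>
      using finFF F(2) by (intro z_Un) auto
    then show ?thesis using finFF by (simp add: PE_def MM J_n_z FF)
  qed
  have "\<theta> / real N * a \<le> W q ts (z FF)"
  proof -
    \<comment> \<open>The weights add up to exactly \<open>q + 1\<close>, which cancels the
      normalisation in \<open>W\<close>.\<close>
    have "real (q + 1) * a = (\<Sum>i\<in>T. real (t * w i) * a)"
      using Sq by (simp add: D_def sum_distrib_left sum_distrib_right mult_ac flip: of_nat_Suc)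
    also have "\<dots> \<le> (\<Sum>i\<in>T. real (t * w i) * z (F i) (\<eta> i))"
      by (intro sum_mono mult_left_mono \<eta>) auto
    also have "\<dots> = (\<Sum>(\<epsilon>, E, \<eta>, h)\<leftarrow>ts. real h * of_int \<epsilon> * PE E (z FF) \<eta>)"
      by (simp add: sum_ts PE)
    finally have "\<theta> / real N * (1 / real (q + 1)) * (real (q + 1) * a) \<le> W q ts (z FF)"
      unfolding W_def using \<theta>_pos by (intro mult_left_mono) auto
    then show ?thesis by simp
  qed
  moreover have "FF \<subseteq> {m..}"
  proof -
    have "m \<le> s i" for i using strict_mono_less_eq[OF s, of 0 i] by (simp add: s_def)
    then have "F i \<subseteq> {m..}" for i using F(1)[of i] by (meson atLeastLessThan_iff atLeast_iff order_trans subset_iff)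
    then show ?thesis by (auto simp: FF_def)
  qed
  moreover have "n (Suc k) \<le> Suc q" if k: "k \<in> FF" for k
  proof -
    obtain i where i: "i \<in> T" "k \<in> F i" using k by (auto simp: FF_def)
    then have "Suc k \<le> s (Suc i)" using F(1)[of i] by auto
    then have "n (Suc k) \<le> n (s (Suc i))" using n by (simp add: strict_mono_less_eq)
    then show ?thesis using rank[OF i(1)] by simp
  qed
  moreover have "r \<le> q" using tq by (simp add: t_def)
  ultimately show ?thesis using finFF by blast
qed

text \<open>Each increase of the age adds an average over fresh blocks, worth at least
  \<open>\<theta> / N * a\<close>, to the value inherited from the preceding node \<xi>.\<close>

lemma age_attained:
  assumes "attains a" "1 \<le> j" "j \<le> N"
  shows "\<exists>F\<subseteq>{m..}. finite F \<and> (\<exists>\<gamma>\<in>\<Gamma>. age \<gamma> = j \<and> (\<forall>k\<in>F. n (Suc k) \<le> node_rank \<gamma>) \<and>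
    real j * (\<theta> / real N * a) \<le> z F \<gamma>)"
  using assms(2,3)
proof (induction j rule: dec_induct)
  case base
  obtain F q ts where F: "F \<subseteq> {m..}" "finite F" "\<forall>k\<in>F. n (Suc k) \<le> Suc q"
    and ts: "adm q {m..q} (\<Gamma>upto q) ts" "\<theta> / real N * a \<le> W q ts (z F)"
    using weighted_attained[OF assms(1), of m 0] by blast
  have ts': "adm q {0..q} (\<Gamma>upto q) ts" using ts(1) by (rule adm_mono) auto
  define \<gamma> where "\<gamma> = NodeA (Suc q) ts"
  have \<gamma>: "\<gamma> \<in> \<Gamma>" "\<gamma> \<noteq> Root" "node_rank \<gamma> = Suc q" "age \<gamma> = 1"
    using NodeA_in[OF ts'] by (simp_all add: \<gamma>_def)
  have "J (Suc q) (z F) = z F" using F(3) by (intro J_z_self) auto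
  then have "z F \<gamma> = cst \<gamma> (z F)" using J_above[OF \<gamma>(1), of "Suc q" "z F"] \<gamma> by simp
  also have "\<dots> = W q ts (z F)"
    using weighted_W[OF ts'] by (simp add: \<gamma>_def cstar_NodeA)
  finally show ?case using F ts(2) \<gamma> by (intro exI[of _ F]) auto
next
  case (step j)
  then obtain F \<xi> where F: "F \<subseteq> {m..}" "finite F" "\<forall>k\<in>F. n (Suc k) \<le> node_rank \<xi>"
    and \<xi>: "\<xi> \<in> \<Gamma>" "age \<xi> = j" "real j * (\<theta> / real N * a) \<le> z F \<xi>"
    by auto
  \<comment> \<open>Since \<open>k \<le> n k\<close>, blocks with index at least \<open>m'\<close>
    begin above the rank of \<xi>. The same bound keeps them disjoint from \<open>F\<close> and
    places the new intervals above that rank.\<close>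
  define m' where "m' = Suc (m + node_rank \<xi>)"
  obtain G q ts where G: "G \<subseteq> {m'..}" "finite G" "\<forall>k\<in>G. n (Suc k) \<le> Suc q" "Suc (node_rank \<xi>) \<le> q"
    and ts: "adm q {m'..q} (\<Gamma>upto q) ts" "\<theta> / real N * a \<le> W q ts (z G)"
    using weighted_attained[OF assms(1), of m' "Suc (node_rank \<xi>)"] by blast
  have ts': "adm q {node_rank \<xi> + 1..q} (\<Gamma>upto q) ts" using ts(1) by (rule adm_mono) (auto simp: m'_def)
  have "\<xi> \<noteq> Root" using \<xi>(2) step.hyps(1) by auto
  then have "0 < node_rank \<xi>" using Root_iff[OF \<xi>(1)] by auto
  define \<gamma> where "\<gamma> = NodeB (Suc q) \<xi> ts"
  have \<gamma>: "\<gamma> \<in> \<Gamma>" "\<gamma> \<noteq> Root" "node_rank \<gamma> = Suc q" "age \<gamma> = Suc j"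
    using NodeB_in[OF ts' \<xi>(1) \<open>0 < node_rank \<xi>\<close>] G(4) \<xi>(2) step.prems by (simp_all add: \<gamma>_def)
  have incr: "k \<le> n k" for k using n by (rule strict_mono_imp_increasing)
  have kF: "k < node_rank \<xi>" if "k \<in> F" for k using F(3) that incr[of "Suc k"] by fastforce
  have disj: "F \<inter> G = {}" using kF G(1) by (fastforce simp: m'_def)
  have z: "z (F \<union> G) = (\<lambda>\<gamma>. z F \<gamma> + z G \<gamma>)" using z_Un[OF F(2) G(2) disj] by blast
  have zG: "z G \<xi> = 0"
  proof -
    have "G \<inter> {..<m'} = {}" using G(1) by auto
    then have "J (n m') (z G) \<xi> = 0" using J_n_z[OF G(2), of m'] by (simp add: z_def)
    then show ?thesis using J_below[OF \<xi>(1), of "n m'" "z G"] incr[of m'] by (simp add: m'_def)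
  qed
  \<comment> \<open>The old blocks end before rank \<open>node_rank \<xi>\<close>, while all new
    intervals begin after it. Both projections defining \<open>PE E\<close> therefore fix
    \<open>z F\<close>, and their difference vanishes on it.\<close>
  have W: "W q ts (z (F \<union> G)) = W q ts (z G)"
  proof -
    have "PE E (z (F \<union> G)) \<eta> = PE E (z G) \<eta>" if "(\<epsilon>, E, \<eta>, h) \<in> set ts" for \<epsilon> E \<eta> h
    proof -
      have "node_rank \<xi> + 1 \<le> Min E" "Min E \<le> Max E"
        using adm_elem(2,3)[OF ts' that] interval_bounds by blast+
      then have "J (Suc (Max E)) (z F) = z F" "J (Min E) (z F) = z F"
        using F(3) by (auto intro!: J_z_self)
      then show ?thesis by (simp add: PE_def z J_add)
    qed
    then show ?thesis unfolding W_def by (simp cong: sum_list_quad_cong)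
  qed
  have below: "n (Suc k) \<le> Suc q" if "k \<in> F \<union> G" for k using that F(3) G(3,4) by fastforce
  have "J (Suc q) (z (F \<union> G)) = z (F \<union> G)" using below by (intro J_z_self) auto
  then have "z (F \<union> G) \<gamma> = cst \<gamma> (z (F \<union> G))"
    using J_above[OF \<gamma>(1), of "Suc q" "z (F \<union> G)"] \<gamma> by simp
  also have "\<dots> = z (F \<union> G) \<xi> + W q ts (z (F \<union> G))"
    using weighted_W[OF ts'] by (simp add: \<gamma>_def cstar_NodeB)
  also have "\<dots> = z F \<xi> + W q ts (z G)" unfolding W by (simp add: z zG)
  finally have "real (Suc j) * (\<theta> / real N * a) \<le> z (F \<union> G) \<gamma>"
    using \<xi>(3) ts(2) by (simp only: of_nat_Suc distrib_right mult_1_left)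
  moreover have "F \<union> G \<subseteq> {m..}" using F(1) G(1) by (auto simp: m'_def)
  ultimately show ?case using F(2) G(2) \<gamma> below by (intro exI[of _ "F \<union> G"]) auto
qed

text \<open>At the maximal age \<open>N\<close>, the \<open>N\<close> contributions
  \<open>\<theta> / N * a\<close> add up to \<open>\<theta> * a\<close>.\<close>

lemma attains_step: "attains a \<Longrightarrow> attains (\<theta> * a)"
  using age_attained[of a N] N_pos unfolding attains_def by fastforce

text \<open>Single blocks attain \<open>c\<close>, so iteration attains
  \<open>\<theta> ^ i * c\<close> for every \<open>i\<close>, and
  \<open>\<theta> > 1\<close>.\<close>

lemma blocks_unbounded:
  assumes "1 < \<theta>" "0 < c" "\<And>k. \<exists>\<eta>\<in>\<Gamma>. c \<le> b k \<eta>"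
  shows "\<exists>F \<gamma>. finite F \<and> K < z F \<gamma>"
proof -
  have "attains c"
    unfolding attains_def
  proof
    fix m
    obtain \<eta> where "\<eta> \<in> \<Gamma>" "c \<le> b m \<eta>" using assms(3) by blast
    then show "\<exists>F\<subseteq>{m..}. finite F \<and> (\<exists>\<eta>\<in>\<Gamma>. c \<le> z F \<eta>)"
      by (intro exI[of _ "{m}"]) (auto simp: z_def)
  qed
  then have pow: "attains (\<theta> ^ i * c)" for i
    by (induction i) (use attains_step in \<open>auto simp: mult.assoc\<close>)
  obtain i where "K / c < \<theta> ^ i" using assms(1) real_arch_pow by blast
  then have "K < \<theta> ^ i * c" using assms(2) by (simp add: divide_less_eq)
  then show ?thesis using pow[of i] unfolding attains_def by (meson less_le_trans)
qed

end

section \<open>Gliding hump for sequences with an upper \<open>c0\<close> estimate\<close>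

definition c0_bounded :: "(nat \<Rightarrow> 'a \<Rightarrow> real) \<Rightarrow> real \<Rightarrow> bool" where
  "c0_bounded u K \<longleftrightarrow> (\<forall>F \<sigma> \<gamma>. finite F \<longrightarrow> (\<forall>k. \<bar>\<sigma> k\<bar> \<le> 1) \<longrightarrow> \<bar>\<Sum>k\<in>F. \<sigma> k * u k \<gamma>\<bar> \<le> K)"

lemma c0_boundedD:
  "c0_bounded u K \<Longrightarrow> finite F \<Longrightarrow> (\<And>k. \<bar>\<sigma> k\<bar> \<le> 1) \<Longrightarrow> \<bar>\<Sum>k\<in>F. \<sigma> k * u k \<gamma>\<bar> \<le> K"
  unfolding c0_bounded_def by blast

text \<open>Choosing the signs of \<open>u k \<gamma>\<close> as coefficients bounds the sums of the
  absolute values, so the coordinates are absolutely summable.\<close>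

lemma coordinates_null:
  assumes "c0_bounded u K"
  shows "(\<lambda>k. u k \<gamma>) \<longlonglongrightarrow> 0"
proof -
  have "(\<Sum>k\<le>m. \<bar>u k \<gamma>\<bar>) \<le> K" for m
  proof -
    have "(\<Sum>k\<le>m. \<bar>u k \<gamma>\<bar>) = (\<Sum>k\<le>m. sgn (u k \<gamma>) * u k \<gamma>)"
      by (intro sum.cong) (auto simp: sgn_if)
    also have "\<dots> \<le> K" using c0_boundedD[OF assms, of "{..m}" "\<lambda>k. sgn (u k \<gamma>)" \<gamma>] by (simp add: abs_sgn_eq)
    finally show ?thesis .
  qed
  then have "summable (\<lambda>k. \<bar>u k \<gamma>\<bar>)"
    by (intro bounded_imp_summable[of _ K]) auto
  then show ?thesis using summable_LIMSEQ_zero tendsto_rabs_zero_iff by blast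
qed

context bd_param
begin

text \<open>\<open>J m\<close> depends on finitely many coordinates only, so pointwise convergence
  suffices for uniform smallness of the projections.\<close>

lemma J_null:
  assumes "\<And>\<gamma>. (\<lambda>k. u k \<gamma>) \<longlonglongrightarrow> 0" "0 < \<delta>"
  shows "\<exists>k0. \<forall>k\<ge>k0. \<forall>\<gamma>. \<bar>J m (u k) \<gamma>\<bar> \<le> \<delta>"
proof -
  have "0 < \<delta> / C" using assms(2) C_ge1 by simp
  then have "\<forall>\<^sub>F k in sequentially. \<bar>u k \<gamma>\<bar> < \<delta> / C" for \<gamma>
    using tendstoD[OF assms(1), of "\<delta> / C" \<gamma>] by simp
  then have "\<forall>\<^sub>F k in sequentially. \<forall>\<gamma>\<in>{\<gamma> \<in> \<Gamma>. node_rank \<gamma> < m}. \<bar>u k \<gamma>\<bar> < \<delta> / C"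
    by (intro eventually_ball_finite finite_below) auto
  then obtain k0 where k0: "\<And>k. k0 \<le> k \<Longrightarrow> \<forall>\<gamma>\<in>{\<gamma> \<in> \<Gamma>. node_rank \<gamma> < m}. \<bar>u k \<gamma>\<bar> < \<delta> / C"
    unfolding eventually_sequentially by blast
  have "\<bar>J m (u k) \<gamma>\<bar> \<le> \<delta>" if "k0 \<le> k" for k \<gamma>
  proof -
    have "\<bar>J m (u k) \<gamma>\<bar> \<le> C * (\<delta> / C)"
      using k0[OF that] assms(2) C_ge1 by (intro J_bound) (auto intro: less_imp_le)
    then show ?thesis using C_ge1 by simp
  qed
  then show ?thesis by blast
qed

text \<open>Along a subsequence each vector is almost concentrated between two ranks: its initial
  part is small because coordinates tend to zero, its tail because it lies in \<open>X\<close>.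
  Cutting there and changing signs gives blocks with positive peaks, and the upper estimate changes
  only by the summable errors.\<close>

lemma gliding_hump:
  fixes u :: "nat \<Rightarrow> node \<Rightarrow>\<^sub>C real"
  assumes X: "\<And>k. u k \<in> X" and c: "0 < c" "\<And>k. c \<le> norm (u k)"
    and K: "c0_bounded (\<lambda>k. apply_bcontfun (u k)) K"
  obtains b n where "strict_mono n" "\<And>k. J (n k) (b k) = (\<lambda>_. 0)" "\<And>k. J (n (Suc k)) (b k) = b k"
    "\<And>k. \<exists>\<eta>\<in>\<Gamma>. c / 4 \<le> b k \<eta>" "\<And>F \<gamma>. finite F \<Longrightarrow> (\<Sum>k\<in>F. b k \<gamma>) \<le> K + c / 4"
proof -
  \<comment> \<open>Each vector is changed by at most \<open>2 * \<delta> i \<le> c / 8\<close>,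
    leaving a peak of at least \<open>c / 4\<close>; all changes together amount to at most
    \<open>c / 4\<close>.\<close>
  define \<delta> where "\<delta> i = c / 16 * (1 / 2) ^ i" for i :: nat
  have \<delta>: "0 < \<delta> i" "\<delta> i \<le> c / 16" for i
    using c(1) by (simp_all add: \<delta>_def mult_le_cancel_left1 power_le_one)
  define R where "R i = (\<lambda>(k::nat, m::nat) (k', m'). k < k' \<and> m < m' \<and>
    (\<forall>\<gamma>. \<bar>J m (u k') \<gamma>\<bar> \<le> \<delta> i) \<and> (\<forall>\<gamma>. \<bar>u k' \<gamma> - J m' (u k') \<gamma>\<bar> \<le> \<delta> i))" for i
  have "\<exists>s. \<forall>i. True \<and> R i (s i) (s (Suc i))"
  proof (rule dependent_nat_choice)
    fix x :: "nat \<times> nat" and i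
    obtain k m where x: "x = (k, m)" by (cases x)
    obtain k0 where k0: "\<forall>k\<ge>k0. \<forall>\<gamma>. \<bar>J m (u k) \<gamma>\<bar> \<le> \<delta> i"
      using J_null[of "\<lambda>k. apply_bcontfun (u k)" "\<delta> i" m] coordinates_null[OF K] \<delta>(1) by blast
    define k' where "k' = max k0 (Suc k)"
    obtain p where p: "\<And>l \<gamma>. p \<le> l \<Longrightarrow> \<bar>u k' \<gamma> - J l (u k') \<gamma>\<bar> \<le> \<delta> i"
      using X_tail[OF X \<delta>(1)] by blast
    have "R i x (k', max p (Suc m))" using k0 p by (auto simp: R_def x k'_def)
    then show "\<exists>y. True \<and> R i x y" by blast
  qed simp
  then obtain s where s: "\<And>i. R i (s i) (s (Suc i))" by blast
  \<comment> \<open>The index shift pairs the vector chosen in step \<open>Suc i\<close> with the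
    cut \<open>n i\<close> chosen before it and the cut \<open>n (Suc i)\<close> chosen after
    it.\<close>
  define \<kappa> where "\<kappa> i = fst (s (Suc i))" for i
  define n where "n i = snd (s i)" for i
  have n: "strict_mono n" and \<kappa>: "strict_mono \<kappa>"
    using s by (simp_all add: strict_mono_Suc_iff n_def \<kappa>_def R_def split_beta)
  have J1: "\<bar>J (n i) (u (\<kappa> i)) \<gamma>\<bar> \<le> \<delta> i" and J2: "\<bar>u (\<kappa> i) \<gamma> - J (n (Suc i)) (u (\<kappa> i)) \<gamma>\<bar> \<le> \<delta> i" for i \<gamma>
    using s[of i] by (simp_all add: R_def n_def \<kappa>_def split_beta)
  define y where "y i = (\<lambda>\<gamma>. J (n (Suc i)) (u (\<kappa> i)) \<gamma> - J (n i) (u (\<kappa> i)) \<gamma>)" for i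
  have y_close: "\<bar>u (\<kappa> i) \<gamma> - y i \<gamma>\<bar> \<le> 2 * \<delta> i" for i \<gamma>
    using J1[of i \<gamma>] J2[of i \<gamma>] unfolding y_def by linarith
  have "\<exists>\<eta>. c / 4 \<le> \<bar>y i \<eta>\<bar>" for i
  proof -
    have "\<exists>\<eta>. c / 2 < \<bar>u (\<kappa> i) \<eta>\<bar>"
    proof (rule ccontr)
      assume "\<not> ?thesis"
      then have "norm (u (\<kappa> i)) \<le> c / 2" by (intro norm_bound) (auto simp: not_less)
      then show False using c(2)[of "\<kappa> i"] c(1) by simp
    qed
    then obtain \<eta> where "c / 2 < \<bar>u (\<kappa> i) \<eta>\<bar>" ..
    then have "c / 4 \<le> \<bar>y i \<eta>\<bar>" using y_close[of i \<eta>] \<delta>(2)[of i] c(1) by linarith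
    then show ?thesis ..
  qed
  then obtain \<eta> where \<eta>: "\<And>i. c / 4 \<le> \<bar>y i (\<eta> i)\<bar>" by metis
  have \<eta>_in: "\<eta> i \<in> \<Gamma>" for i
  proof (rule ccontr)
    assume "\<eta> i \<notin> \<Gamma>"
    then have "y i (\<eta> i) = 0" by (simp add: y_def J_outside)
    then show False using \<eta>[of i] c(1) by simp
  qed
  define \<tau> where "\<tau> i = sgn (y i (\<eta> i))" for i
  have \<tau>: "\<bar>\<tau> i\<bar> \<le> 1" "c / 4 \<le> \<tau> i * y i (\<eta> i)" for i
    using \<eta>[of i] by (auto simp: \<tau>_def sgn_if)
  define b where "b i = (\<lambda>\<gamma>. \<tau> i * y i \<gamma>)" for i
  have n_le: "n i \<le> n (Suc i)" for i using n by (simp add: strict_mono_less_eq)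
  show ?thesis
  proof (rule that[OF n, of b])
    show "J (n k) (b k) = (\<lambda>_. 0)" for k
      using n_le[of k] by (simp add: b_def y_def J_scale J_diff J_J min_def)
    show "J (n (Suc k)) (b k) = b k" for k
      using n_le[of k] by (simp add: b_def y_def J_scale J_diff J_J min_def)
    show "\<exists>\<eta>\<in>\<Gamma>. c / 4 \<le> b k \<eta>" for k
      using \<tau>(2)[of k] \<eta>_in[of k] by (auto simp: b_def)
    fix F :: "nat set" and \<gamma> assume F: "finite F"
    have inj: "inj_on \<kappa> F" "inj \<kappa>" using \<kappa> strict_mono_imp_inj_on inj_on_subset by blast+
    \<comment> \<open>Reindexing by \<kappa> gives a sum over the original sequence. Off the range
      of \<kappa> the value of \<open>inv \<kappa>\<close> is arbitrary, but the coefficients still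
      have modulus at most \<open>1\<close>.\<close>
    have "(\<Sum>k\<in>F. \<tau> k * u (\<kappa> k) \<gamma>) = (\<Sum>k\<in>\<kappa> ` F. \<tau> (inv \<kappa> k) * u k \<gamma>)"
      using inj by (simp add: sum.reindex o_def)
    also have "\<dots> \<le> K"
      using c0_boundedD[OF K, of "\<kappa> ` F" "\<lambda>k. \<tau> (inv \<kappa> k)" \<gamma>] F \<tau>(1) by simp
    finally have 1: "(\<Sum>k\<in>F. \<tau> k * u (\<kappa> k) \<gamma>) \<le> K" .
    have "b k \<gamma> \<le> \<tau> k * u (\<kappa> k) \<gamma> + 2 * \<delta> k" for k
    proof -
      have "\<bar>\<tau> k * (y k \<gamma> - u (\<kappa> k) \<gamma>)\<bar> \<le> 1 * (2 * \<delta> k)"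
        unfolding abs_mult using \<tau>(1) y_close[of k \<gamma>] \<delta>(1)[of k]
        by (intro mult_mono) (auto simp: abs_minus_commute)
      then show ?thesis by (simp add: b_def algebra_simps)
    qed
    then have "(\<Sum>k\<in>F. b k \<gamma>) \<le> (\<Sum>k\<in>F. \<tau> k * u (\<kappa> k) \<gamma> + 2 * \<delta> k)" by (intro sum_mono)
    also have "\<dots> = (\<Sum>k\<in>F. \<tau> k * u (\<kappa> k) \<gamma>) + c / 8 * (\<Sum>k\<in>F. (1 / 2) ^ k)"
      by (simp add: sum.distrib \<delta>_def sum_distrib_left)
    also have "(\<Sum>k\<in>F. (1 / 2 :: real) ^ k) \<le> (\<Sum>k. (1 / 2) ^ k)"
      using F by (intro sum_le_suminf summable_geometric) auto
    also have "(\<Sum>k. (1 / 2 :: real) ^ k) = 2" by (subst suminf_geometric) auto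
    finally show "(\<Sum>k\<in>F. b k \<gamma>) \<le> K + c / 4" using 1 c(1) by simp
  qed
qed

lemma not_contains_c0:
  assumes "1 < \<theta>" "0 < \<omega>" "compact_family \<M>" "\<And>A. A \<in> \<M> \<Longrightarrow> finite A"
    and u: "\<And>k. u k \<in> X" "0 < c" "\<And>k. c \<le> norm (u k)"
      "c0_bounded (\<lambda>k. apply_bcontfun (u k)) K"
  shows False
proof -
  obtain b n where n: "strict_mono n" "\<And>k. J (n k) (b k) = (\<lambda>_. 0)" "\<And>k. J (n (Suc k)) (b k) = b k"
    and b: "\<And>k. \<exists>\<eta>\<in>\<Gamma>. c / 4 \<le> b k \<eta>" "\<And>F \<gamma>. finite F \<Longrightarrow> (\<Sum>k\<in>F. b k \<gamma>) \<le> K + c / 4"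
    using gliding_hump[OF u] by metis
  interpret bd_blocks N \<theta> \<omega> \<M> b n
    by unfold_locales (use assms n in auto)
  have "0 < c / 4" using u(2) by simp
  from blocks_unbounded[OF assms(1) this b(1)] obtain F \<gamma> where "finite F" "K + c / 4 < z F \<gamma>" by blast
  then show False using b(2)[of F \<gamma>] by (simp add: z_def)
qed

end

text \<open>The vectors are the preimages of the unit vectors of \<open>c0\<close>. Continuity of
  \<open>f\<close> at zero bounds their norms from below; continuity of \<open>g\<close> at zero
  gives the upper estimate.\<close>

lemma c0_basis_in_copy:
  fixes X :: "('a::topological_space \<Rightarrow>\<^sub>C real) set"
  assumes "contains_copy X c0"
  obtains u c K where "\<And>k. u k \<in> X" "0 < c" "\<And>k. c \<le> norm (u k)"
    "c0_bounded (\<lambda>k. apply_bcontfun (u k)) K"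
proof -
  obtain Y f g where Y: "subspace Y" "Y \<subseteq> X"
    and add: "\<forall>x\<in>Y. \<forall>y\<in>Y. f (x + y) = f x + f y" and scale: "\<forall>r. \<forall>x\<in>Y. f (r *\<^sub>R x) = r *\<^sub>R f x"
    and h: "homeomorphism Y c0 f g"
    using assms unfolding contains_copy_def isomorphic_subspaces_def by blast
  have fg: "\<And>x. x \<in> c0 \<Longrightarrow> f (g x) = x" "\<And>x. x \<in> c0 \<Longrightarrow> g x \<in> Y" "\<And>y. y \<in> Y \<Longrightarrow> g (f y) = y"
    "continuous_on Y f" "continuous_on c0 g"
    using h unfolding homeomorphism_def by auto
  have f0: "f 0 = 0" using scale[rule_format, of 0 0] subspace_0[OF Y(1)] by simp
  have zero: "0 \<in> c0" by (simp add: c0_def zero_bcontfun.rep_eq)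
  have g0: "g 0 = 0" using fg(3)[OF subspace_0[OF Y(1)]] f0 by simp
  define e :: "nat \<Rightarrow> nat \<Rightarrow>\<^sub>C real" where "e k = Bcontfun (indicator {k})" for k
  have e: "apply_bcontfun (e k) = indicator {k}" for k
  proof -
    have "(indicator {k} :: nat \<Rightarrow> real) \<in> bcontfun"
      by (auto simp: bcontfun_def bounded_iff indicator_def intro!: exI[of _ 1])
    then show ?thesis by (simp add: e_def Bcontfun_inverse)
  qed
  define comb where "comb F \<sigma> = (\<Sum>k\<in>F. \<sigma> k *\<^sub>R e k)" for F and \<sigma> :: "nat \<Rightarrow> real"
  have comb: "apply_bcontfun (comb F \<sigma>) j = (if j \<in> F then \<sigma> j else 0)" if "finite F" for F \<sigma> j
  proof -
    have "apply_bcontfun (comb F \<sigma>) j = (\<Sum>k\<in>F. if j = k then \<sigma> k else 0)"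
      unfolding comb_def apply_sum by (intro sum.cong) (auto simp: scaleR_bcontfun.rep_eq e)
    then show ?thesis using that by simp
  qed
  have comb_c0: "comb F \<sigma> \<in> c0" if F: "finite F" for F \<sigma>
  proof -
    obtain m where m: "\<forall>k\<in>F. k < m" using F finite_nat_set_iff_bounded by auto
    have "\<forall>\<^sub>F j in sequentially. apply_bcontfun (comb F \<sigma>) j = 0"
      using eventually_ge_at_top[of m] by eventually_elim (use m in \<open>auto simp: comb[OF F]\<close>)
    then show ?thesis by (simp add: c0_def tendsto_eventually)
  qed
  have e_comb: "e k = comb {k} (\<lambda>_. 1)" for k by (simp add: comb_def)
  have e_c0: "e k \<in> c0" for k unfolding e_comb by (rule comb_c0) simp
  define u where "u k = g (e k)" for k
  have u: "u k \<in> Y" "f (u k) = e k" for k using fg(1,2) e_c0 by (auto simp: u_def)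
  \<comment> \<open>Additivity and homogeneity are given for \<open>f\<close>, so linear
    combinations are computed through \<open>f\<close> and then inverted by
    \<open>g\<close>.\<close>
  have f_sum: "(\<Sum>k\<in>F. \<sigma> k *\<^sub>R u k) \<in> Y \<and> f (\<Sum>k\<in>F. \<sigma> k *\<^sub>R u k) = comb F \<sigma>" if "finite F" for F \<sigma>
    using that
  proof (induction rule: finite_induct)
    case empty
    then show ?case using subspace_0[OF Y(1)] f0 by (simp add: comb_def)
  next
    case (insert k F)
    have "\<sigma> k *\<^sub>R u k \<in> Y" using u(1) subspace_scale[OF Y(1)] by blast
    then show ?case
      using insert u add scale subspace_add[OF Y(1)] by (simp add: comb_def)
  qed
  obtain d where d: "0 < d" "\<And>y. y \<in> Y \<Longrightarrow> norm y < d \<Longrightarrow> norm (f y) < 1"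
    using fg(4) subspace_0[OF Y(1)] f0 unfolding continuous_on_iff by (metis dist_0_norm dist_commute zero_less_one)
  obtain d' where d': "0 < d'" "\<And>y. y \<in> c0 \<Longrightarrow> norm y < d' \<Longrightarrow> norm (g y) < 1"
    using fg(5) zero g0 unfolding continuous_on_iff by (metis dist_0_norm dist_commute zero_less_one)
  show ?thesis
  \<comment> \<open>The factor \<open>d' / 2\<close> brings every combination with coefficients of
    modulus at most \<open>1\<close> into the ball of radius \<open>d'\<close>, where
    \<open>g\<close> has norm below \<open>1\<close>; scaling back gives the constant
    \<open>2 / d'\<close>.\<close>
  proof (rule that[of u d "2 / d'"])
    show "u k \<in> X" for k using u(1) Y(2) by blast
    show "0 < d" by fact
    show "d \<le> norm (u k)" for k
    proof (rule ccontr)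
      assume "\<not> d \<le> norm (u k)"
      then have "norm (e k) < 1" using d(2)[OF u(1)[of k]] unfolding u(2)[of k] by simp
      then show False using norm_bounded[of "e k" k] by (simp add: e)
    qed
    show "c0_bounded (\<lambda>k. apply_bcontfun (u k)) (2 / d')"
      unfolding c0_bounded_def
    proof (intro allI impI)
      fix F :: "nat set" and \<sigma> :: "nat \<Rightarrow> real" and \<gamma>
      assume F: "finite F" and \<sigma>: "\<forall>k. \<bar>\<sigma> k\<bar> \<le> 1"
      define \<sigma>' where "\<sigma>' k = d' / 2 * \<sigma> k" for k
      define v where "v = (\<Sum>k\<in>F. \<sigma>' k *\<^sub>R u k)"
      have "norm (comb F \<sigma>') \<le> d' / 2"
        using \<sigma> d'(1) by (intro norm_bound) (auto simp: comb[OF F] \<sigma>'_def abs_mult)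
      then have "norm (g (comb F \<sigma>')) < 1" using d' comb_c0[OF F] by simp
      moreover have "g (comb F \<sigma>') = v" using f_sum[OF F] fg(3) by (metis v_def)
      ultimately have "\<bar>apply_bcontfun v \<gamma>\<bar> < 1" using norm_bounded[of v \<gamma>] by simp
      moreover have "apply_bcontfun v \<gamma> = d' / 2 * (\<Sum>k\<in>F. \<sigma> k * apply_bcontfun (u k) \<gamma>)"
        unfolding v_def apply_sum by (simp add: scaleR_bcontfun.rep_eq \<sigma>'_def sum_distrib_left mult.assoc)
      ultimately show "\<bar>\<Sum>k\<in>F. \<sigma> k * apply_bcontfun (u k) \<gamma>\<bar> \<le> 2 / d'"
        using d'(1) by (simp add: abs_mult field_simps)
    qed
  qed
qed

theorem proposition4p5:
  fixes N :: nat and \<theta> \<omega> :: real and \<M> :: "nat set set"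
  assumes "3 \<le> N" and "1 < \<theta>" and "\<theta> < real N / 2" and "0 < \<omega>" and "\<omega> < 1 / \<theta>"
    and "compact_family \<M>"
  shows "((\<exists>A\<in>\<M>. infinite A) \<longrightarrow> isomorphic_subspaces (BD_space N \<theta> \<omega> \<M>) c0) \<and>
         ((\<forall>A\<in>\<M>. finite A) \<longrightarrow> \<not> contains_copy (BD_space N \<theta> \<omega> \<M>) c0)"
proof (intro conjI impI notI)
  interpret bd_param N \<theta> \<omega> \<M>
    by unfold_locales (use assms in auto)
  have \<theta>\<omega>: "\<theta> * \<omega> < 1" using assms(2,5) by (simp add: field_simps)
  {
    assume "\<exists>A\<in>\<M>. infinite A"
    then obtain A where "A \<in> \<M>" "infinite A" by blast
    then interpret bd_infinite N \<theta> \<omega> \<M> A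
      by unfold_locales (use assms(4) \<theta>\<omega> in auto)
    show "isomorphic_subspaces X c0" by (rule isomorphic_c0)
  next
    assume fin: "\<forall>A\<in>\<M>. finite A" and "contains_copy X c0"
    from c0_basis_in_copy[OF this(2)] obtain u c K
      where u: "\<And>k. u k \<in> X" "0 < c" "\<And>k. c \<le> norm (u k)" "c0_bounded (\<lambda>k. apply_bcontfun (u k)) K"
      by blast
    show False
      by (rule not_contains_c0[OF assms(2,4,6) _ u]) (use fin in blast)
  }
qed

end
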